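(* Let $M=(\Omega,P,\dagger)$ be a transient, locally finite, irreducible Markov chain with killing such that $P(x,x)=0$ for every $x\neq\dagger$, let $X=(X_n)_{n\geq0}$ be a trajectory of $M$, and let $\phi:[0,\infty)\to[0,\infty)$ be an increasing bijection such that \[ \sum_{n=1}^\infty\frac{1}{1\vee\log(\phi^{-1}(n))}=\infty . \] If the event $\mathscr{G}=\{\limsup_{n\to\infty}e^{\phi(n)}\mathbb{H}(X_n,X_0)<\infty\}$ has positive probability, then, almost surely conditional on $\mathscr{G}$, $X$ is either killed or has infinitely many cut times.
   Context: A Markov chain with killing is a tuple $M=(\Omega,P,\dagger)$ with $\Omega$ countable, $P$ a transition kernel on $\Omega$, and $\dagger\in\Omega$ a graveyard state with $P(\dagger,\dagger)=1$. It is locally finite if $\{v:P(u,v)>0\}$ is finite for every $u$; irreducible if for all $u,v\in\Omega\setminus\{\dagger\}$ there is $n$ with $P^n(u,v)>0$; transient if every state other than $\dagger$ is visited finitely often almost surely. A trajectory is killed if it ever hits $\dagger$. $\mathbb{H}(x,y)$ is the probability that the chain started at $x$ ever hits $y$ (at some time $\geq 0$). $\phi^{-1}$ is the inverse function of $\phi$. A cut time of a sequence $(x_n)_{n\geq 0}$ is an integer $n\geq 0$ such that $\{x_i:i\leq n\}$ and $\{x_i:i>n\}$ are disjoint. *)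

theory Defs
  imports "HOL-Probability.Probability"
begin

definition killing_chain :: "('a::countable \<Rightarrow> 'a pmf) \<Rightarrow> 'a \<Rightarrow> bool" where
  "killing_chain P dag \<longleftrightarrow> pmf (P dag) dag = 1"

definition locally_finite :: "('a::countable \<Rightarrow> 'a pmf) \<Rightarrow> bool" where
  "locally_finite P \<longleftrightarrow> (\<forall>u. finite {v. pmf (P u) v > 0})"

fun kernel_pow :: "('a::countable \<Rightarrow> 'a pmf) \<Rightarrow> nat \<Rightarrow> 'a \<Rightarrow> 'a pmf" where
  "kernel_pow P 0 u = return_pmf u"
| "kernel_pow P (Suc n) u = bind_pmf (kernel_pow P n u) P"

definition irreducible_chain :: "('a::countable \<Rightarrow> 'a pmf) \<Rightarrow> 'a \<Rightarrow> bool" where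
  "irreducible_chain P dag \<longleftrightarrow>
     (\<forall>u v. u \<noteq> dag \<longrightarrow> v \<noteq> dag \<longrightarrow> (\<exists>n. pmf (kernel_pow P n u) v > 0))"

definition trajectory ::
  "'w measure \<Rightarrow> ('a::countable \<Rightarrow> 'a pmf) \<Rightarrow> (nat \<Rightarrow> 'w \<Rightarrow> 'a) \<Rightarrow> bool" where
  "trajectory M P X \<longleftrightarrow> prob_space M \<and>
     (\<forall>n. X n \<in> measurable M (count_space UNIV)) \<and>
     (\<forall>n xs. length xs = Suc n \<longrightarrow>
        measure M {\<omega> \<in> space M. \<forall>i\<le>n. X i \<omega> = xs ! i}
        = measure M {\<omega> \<in> space M. X 0 \<omega> = xs ! 0}
          * (\<Prod>i<n. pmf (P (xs ! i)) (xs ! Suc i)))"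

definition transient_traj ::
  "'w measure \<Rightarrow> (nat \<Rightarrow> 'w \<Rightarrow> 'a) \<Rightarrow> 'a \<Rightarrow> bool" where
  "transient_traj M X dag \<longleftrightarrow>
     (AE \<omega> in M. \<forall>v. v \<noteq> dag \<longrightarrow> finite {n. X n \<omega> = v})"

fun hit_within :: "('a::countable \<Rightarrow> 'a pmf) \<Rightarrow> nat \<Rightarrow> 'a \<Rightarrow> 'a \<Rightarrow> real" where
  "hit_within P 0 x y = (if x = y then 1 else 0)"
| "hit_within P (Suc n) x y =
     (if x = y then 1 else measure_pmf.expectation (P x) (\<lambda>z. hit_within P n z y))"

definition hit_prob :: "('a::countable \<Rightarrow> 'a pmf) \<Rightarrow> 'a \<Rightarrow> 'a \<Rightarrow> real" where
  "hit_prob P x y = (SUP n. hit_within P n x y)"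

definition cut_time :: "(nat \<Rightarrow> 'a) \<Rightarrow> nat \<Rightarrow> bool" where
  "cut_time x n \<longleftrightarrow> {x i | i. i \<le> n} \<inter> {x i | i. i > n} = {}"

end

theory Submission
  imports Defs
begin

text \<open>
  Write \<open>Y n\<close> for the probability that the chain hits \<open>X 0\<close> from \<open>X n\<close>; this is a
  supermartingale with values in \<open>[0,1]\<close>, and \<open>n\<close> is a cut time as soon as \<open>Y\<close> stays below its
  running minimum \<open>m n\<close> at all later times (the event \<open>escape n\<close>). By the maximal inequality, the
  conditional probability of \<open>escape n\<close> at time \<open>n + 1\<close> is at least the relative drop
  \<open>q n = (m n - m (n + 1)) / m n\<close>. Give the drop \<open>q n\<close> the weight \<open>1\<close> if \<open>q n \<ge> 1/2\<close>, the weight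
  \<open>1 / (1 + ln (n + 1))\<close> if \<open>1/2 > q n \<ge> 1 / (n + 1)\<^sup>2\<close>, and \<open>0\<close> otherwise. On the event in
  question, divergence of \<open>\<Sum> 1 / (1 \<or> ln (\<phi>\<^sup>-\<^sup>1 n))\<close> forces the weighted drops to have infinite sum.
  On the other hand, the weights keep the correlations between the escape events bounded, so by the
  second moment method the probability of some escape after time \<open>n\<close>, within any event of the past,
  is at least a constant times the probability that the weighted drops have infinite sum.
  Approximating the event of infinite sum and no escape after time \<open>m\<close> by events of the past then
  shows that it is a null set.
\<close>

section \<open>Running minima, relative drops and deterministic bounds for weighted drops\<close>

primrec running_min :: "(nat \<Rightarrow> real) \<Rightarrow> nat \<Rightarrow> real" where
  "running_min y 0 = y 0"
| "running_min y (Suc n) = min (running_min y n) (y (Suc n))"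

lemma running_min_le: "i \<le> n \<Longrightarrow> running_min y n \<le> y i"
  by (induction n) (auto simp: le_Suc_eq min.coboundedI1)

lemma decseq_running_min: "decseq (running_min y)"
  by (rule decseq_SucI) simp

lemma running_min_nonneg: "(\<And>n. 0 \<le> y n) \<Longrightarrow> 0 \<le> running_min y n"
  by (induction n) auto

lemma running_min_pos: "(\<And>n. 0 < y n) \<Longrightarrow> 0 < running_min y n"
  by (induction n) auto

text \<open>Where \<open>m n = 0\<close>, division by zero makes the drop \<open>0\<close>, so the
  bounds by \<open>0\<close> and \<open>1\<close> hold for every nonnegative decreasing
  sequence.\<close>

definition relative_drop :: "(nat \<Rightarrow> real) \<Rightarrow> nat \<Rightarrow> real" where
  "relative_drop m n = (m n - m (Suc n)) / m n"

definition log_weight :: "nat \<Rightarrow> real" where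
  "log_weight n = 1 / (1 + ln (real n + 1))"

text \<open>Drops below \<open>1 / (n + 1)^2\<close> are summable by themselves and may be
  discarded. Discarding them leaves an increment only a range polynomial in \<open>n\<close>, whose
  logarithm \<open>log_weight\<close> cancels.\<close>

definition drop_weight :: "nat \<Rightarrow> real \<Rightarrow> real" where
  "drop_weight n q = (if q \<ge> 1/2 then 1
     else if q \<ge> 1 / (real n + 1)\<^sup>2 then log_weight n else 0)"

lemma log_weight_pos: "0 < log_weight n"
proof -
  have "0 \<le> ln (real n + 1)" by simp
  then have "0 < 1 + ln (real n + 1)" by linarith
  then show ?thesis by (simp add: log_weight_def)
qed

lemma log_weight_le_1: "log_weight n \<le> 1"
proof -
  have "0 \<le> ln (real n + 1)" by simp
  then show ?thesis unfolding log_weight_def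
    by (intro divide_le_eq_1_pos[THEN iffD2]) linarith+
qed

lemma log_weight_antimono: "i \<le> j \<Longrightarrow> log_weight j \<le> log_weight i"
proof -
  assume "i \<le> j"
  moreover have "0 \<le> ln (real i + 1)" by simp
  ultimately show ?thesis unfolding log_weight_def
    by (intro divide_left_mono mult_pos_pos add_left_mono add_pos_nonneg) auto
qed

lemma drop_weight_nonneg: "0 \<le> drop_weight n q"
  using log_weight_pos[of n] by (simp add: drop_weight_def)

lemma drop_weight_le_1: "drop_weight n q \<le> 1"
  using log_weight_le_1[of n] by (simp add: drop_weight_def)

lemma relative_drop_nonneg:
  "decseq m \<Longrightarrow> (\<And>n. 0 \<le> m n) \<Longrightarrow> 0 \<le> relative_drop m n"
  using decseqD[of m n "Suc n"] by (simp add: relative_drop_def)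

lemma relative_drop_le_1: "(\<And>n. 0 \<le> m n) \<Longrightarrow> relative_drop m n \<le> 1"
  using divide_right_mono[of "m n - m (Suc n)" "m n" "m n"]
  by (cases "m n = 0") (simp_all add: relative_drop_def)

text \<open>The increments telescope to \<open>ln (d N)\<close>, and \<open>log_weight\<close> compensates this logarithm because the
  first increment that counts already brings \<open>d\<close> above \<open>K / (j + 1)\<^sup>2\<close>.\<close>

lemma log_weighted_increments_bound:
  fixes d :: "nat \<Rightarrow> real"
  assumes inc: "incseq d" and d0: "\<And>j. i \<le> j \<Longrightarrow> 0 \<le> d j" and K: "0 < K"
    and S: "\<And>j. i \<le> j \<Longrightarrow> S j \<Longrightarrow> d (Suc j) < K \<and> K / (real j + 1)\<^sup>2 \<le> d (Suc j)"
  shows "(\<Sum>j=i..<N. if S j then log_weight j * ((d (Suc j) - d j) / d (Suc j)) else 0) \<le> 2"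
    (is "?T N \<le> 2")
proof -
  \<comment> \<open>Here \<open>k\<close> is the first counted index. Its own term costs at most
    \<open>log_weight k\<close>, and all later terms telescope into the logarithm. The cap
    \<open>min (d N) K\<close> allows \<open>d\<close> to pass \<open>K\<close>, after which no
    index is counted.\<close>
  have step: "?T N = 0 \<or> (\<exists>k. i \<le> k \<and> k < N \<and> K / (real k + 1)\<^sup>2 \<le> d (Suc k) \<and>
      d (Suc k) < K \<and> ?T N \<le> log_weight k * (1 + ln (min (d N) K / d (Suc k))))" for N
  proof (induction N)
    case 0 then show ?case by simp
  next
    case (Suc N)
    show ?case
    proof (cases "i \<le> N \<and> S N")
      case False
      then have eq: "?T (Suc N) = ?T N" by auto
      show ?thesis
        using Suc
      proof (elim disjE exE conjE)
        assume "?T N = 0" then show ?thesis using eq by simp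
      next
        fix k assume k: "i \<le> k" "k < N" "K / (real k + 1)\<^sup>2 \<le> d (Suc k)" "d (Suc k) < K"
          "?T N \<le> log_weight k * (1 + ln (min (d N) K / d (Suc k)))"
        have dk: "0 < d (Suc k)" by (rule less_le_trans[OF _ k(3)]) (use K in simp)
        have "d (Suc k) \<le> d N" using k inc by (auto intro: incseqD)
        then have "ln (min (d N) K / d (Suc k)) \<le> ln (min (d (Suc N)) K / d (Suc k))"
          using dk K incseq_SucD[OF inc, of N]
          by (subst ln_le_cancel_iff) (auto intro!: divide_right_mono divide_pos_pos)
        then have "log_weight k * (1 + ln (min (d N) K / d (Suc k))) \<le>
            log_weight k * (1 + ln (min (d (Suc N)) K / d (Suc k)))"
          using log_weight_pos[of k] by (intro mult_left_mono) auto
        then show ?thesis using eq k by (intro disjI2 exI[of _ k]) linarith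
      qed
    next
      case True
      then have eq: "?T (Suc N) = ?T N + log_weight N * ((d (Suc N) - d N) / d (Suc N))" by auto
      have SN: "d (Suc N) < K" "K / (real N + 1)\<^sup>2 \<le> d (Suc N)" using S True by auto
      have dN: "0 < d (Suc N)" by (rule less_le_trans[OF _ SN(2)]) (use K in simp)
      show ?thesis
        using Suc
      proof (elim disjE exE conjE)
        assume z: "?T N = 0"
        have "(d (Suc N) - d N) / d (Suc N) \<le> 1" using dN d0[of N] True by simp
        then have "?T (Suc N) \<le> log_weight N * 1"
          unfolding eq z using log_weight_pos[of N] by (simp only: add_0) (intro mult_left_mono, auto)
        moreover have "min (d (Suc N)) K / d (Suc N) = 1" using SN dN by simp
        ultimately show ?thesis using SN True
          by (intro disjI2 exI[of _ N]) auto
      next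
        fix k assume k: "i \<le> k" "k < N" "K / (real k + 1)\<^sup>2 \<le> d (Suc k)" "d (Suc k) < K"
          "?T N \<le> log_weight k * (1 + ln (min (d N) K / d (Suc k)))"
        have dk: "0 < d (Suc k)" by (rule less_le_trans[OF _ k(3)]) (use K in simp)
        have le: "d (Suc k) \<le> d N" "d N \<le> d (Suc N)" using k inc by (auto intro: incseqD)
        have dNp: "0 < d N" using le dk by linarith
        have m: "min (d N) K = d N" "min (d (Suc N)) K = d (Suc N)" using le SN by auto
        \<comment> \<open>With \<open>x = d N / d (Suc N)\<close>, the inequality
          \<open>ln x <= x - 1\<close> bounds the relative increment \<open>1 - x\<close> by a
          difference of logarithms.\<close>
        have "ln (d N / d (Suc N)) \<le> d N / d (Suc N) - 1"
          using dNp dN by (intro ln_le_minus_one) simp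
        then have "(d (Suc N) - d N) / d (Suc N) \<le> ln (d (Suc N)) - ln (d N)"
          using dNp dN by (simp add: ln_div field_simps)
        moreover have "0 \<le> (d (Suc N) - d N) / d (Suc N)" using le dN by simp
        ultimately have "log_weight N * ((d (Suc N) - d N) / d (Suc N)) \<le> log_weight k * (ln (d (Suc N)) - ln (d N))"
          using log_weight_antimono[of k N] log_weight_pos[of k] k by (intro mult_mono) auto
        then have "?T (Suc N) \<le> log_weight k * (1 + ln (d N / d (Suc k))) + log_weight k * (ln (d (Suc N)) - ln (d N))"
          using k(5) m eq by simp
        also have "\<dots> = log_weight k * (1 + ln (d (Suc N) / d (Suc k)))"
          using dNp dN dk by (simp add: ln_div algebra_simps)
        finally show ?thesis using k m by (intro disjI2 exI[of _ k]) auto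
      qed
    qed
  qed
  show ?thesis using step[of N]
  proof (elim disjE exE conjE)
    fix k assume k: "i \<le> k" "k < N" "K / (real k + 1)\<^sup>2 \<le> d (Suc k)" "d (Suc k) < K"
          "?T N \<le> log_weight k * (1 + ln (min (d N) K / d (Suc k)))"
    have dk: "0 < d (Suc k)" by (rule less_le_trans[OF _ k(3)]) (use K in simp)
    have "d (Suc k) \<le> d N" using k inc by (auto intro: incseqD)
    then have p: "0 < min (d N) K" using dk K by auto
    have kp: "0 < (real k + 1)\<^sup>2" by simp
    \<comment> \<open>The ratio lies below \<open>(k + 1)^2\<close>, so the bracket is at most
      \<open>1 + 2 * ln (k + 1)\<close>, which is at most twice the reciprocal of
      \<open>log_weight k\<close>.\<close>
    have "min (d N) K / d (Suc k) \<le> K / d (Suc k)"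
      using dk by (intro divide_right_mono) auto
    also have "\<dots> \<le> (real k + 1)\<^sup>2" using k(3) dk kp by (simp add: field_simps)
    finally have "ln (min (d N) K / d (Suc k)) \<le> ln ((real k + 1)\<^sup>2)"
      using p dk kp by (subst ln_le_cancel_iff) auto
    also have "\<dots> = 2 * ln (real k + 1)" by (simp add: ln_realpow)
    finally have "log_weight k * (1 + ln (min (d N) K / d (Suc k))) \<le> log_weight k * (1 + 2 * ln (real k + 1))"
      using log_weight_pos[of k] by (intro mult_left_mono) auto
    also have "\<dots> \<le> 2"
    proof -
      have "0 \<le> ln (real k + 1)" by simp
      then have "0 < 1 + ln (real k + 1)" by linarith
      then show ?thesis by (simp add: log_weight_def divide_simps)
    qed
    finally show ?thesis using k by linarith
  qed simp
qed

text \<open>The factor \<open>m i / (m i - m (Suc j))\<close> is the reciprocal of the escape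
  probability bound \<open>1 - m (Suc j) / m i\<close>. While \<open>m (Suc j) <= m i / 2\<close> it
  is at most \<open>2\<close>, and the assumed bound on the sum gives \<open>4\<close>. Otherwise
  \<open>m\<close> has lost less than half of \<open>m i\<close>, and the logarithmic bound for
  \<open>d j = m i - m j\<close> gives another \<open>4\<close>.\<close>

lemma weighted_drops_bound:
  fixes m a :: "nat \<Rightarrow> real"
  assumes dec: "decseq m" and nn: "\<And>n. 0 \<le> m n"
    and a0: "\<And>j. 0 \<le> a j" and ac: "\<And>j. a j \<le> drop_weight j (relative_drop m j)"
    and sum: "(\<Sum>j=i..<N. a j * relative_drop m j) \<le> 2"
  shows "(\<Sum>j=i..<N. a j * relative_drop m j * (m i / (m i - m (Suc j)))) \<le> 8"
proof (cases "m i = 0")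
  case True then show ?thesis by simp
next
  case False
  then have mi: "0 < m i" using nn[of i] by simp
  define S where "S j \<longleftrightarrow> m i / 2 < m (Suc j) \<and> 1 / (real j + 1)\<^sup>2 \<le> relative_drop m j" for j
  define d where "d j = m i - m j" for j
  have "a j * relative_drop m j * (m i / (m i - m (Suc j))) \<le>
     2 * (a j * relative_drop m j) +
     2 * (if S j then log_weight j * ((d (Suc j) - d j) / d (Suc j)) else 0)" if j: "i \<le> j" for j
  proof -
    have mj: "m (Suc j) \<le> m j" "m j \<le> m i" using j dec by (auto intro: decseqD)
    have q0: "0 \<le> relative_drop m j" using dec nn by (rule relative_drop_nonneg)
    have aq0: "0 \<le> a j * relative_drop m j" using q0 a0 by simp
    have S0: "0 \<le> (if S j then log_weight j * ((d (Suc j) - d j) / d (Suc j)) else 0)"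
      using mj log_weight_pos[of j] by (auto simp: d_def intro!: mult_nonneg_nonneg divide_nonneg_nonneg)
    show ?thesis
    proof (cases "m (Suc j) \<le> m i / 2")
      case True
      then have "m i / (m i - m (Suc j)) \<le> 2" using mi nn[of "Suc j"] by (simp add: divide_simps)
      then have "a j * relative_drop m j * (m i / (m i - m (Suc j))) \<le> a j * relative_drop m j * 2"
        using aq0 by (rule mult_left_mono)
      then show ?thesis using S0 by linarith
    next
      case f: False
      then have h: "m i / 2 < m (Suc j)" by simp
      have mjp: "0 < m j" "0 < m (Suc j)" using h mj mi by linarith+
      \<comment> \<open>Both \<open>m j\<close> and \<open>m (Suc j)\<close> lie between
        \<open>m i / 2\<close> and \<open>m i\<close>, which excludes the case of weight
        \<open>1\<close>.\<close>
      have "\<not> 1/2 \<le> relative_drop m j" using h mj mi mjp by (simp add: relative_drop_def field_simps)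
      show ?thesis
      proof (cases "S j")
        case False
        then have "a j = 0" using h \<open>\<not> 1/2 \<le> relative_drop m j\<close> ac[of j] a0[of j]
          by (auto simp: S_def drop_weight_def)
        then show ?thesis using S0 by simp
      next
        case True
        have pos: "0 < relative_drop m j"
          by (rule less_le_trans[of 0 "1 / (real j + 1)\<^sup>2"]) (use True in \<open>simp_all add: S_def\<close>)
        then have lt: "m (Suc j) < m j" using mjp by (simp add: relative_drop_def divide_simps)
        have "a j \<le> log_weight j" using ac[of j] \<open>\<not> 1/2 \<le> relative_drop m j\<close> log_weight_pos[of j]
          by (auto simp: drop_weight_def split: if_splits)
        moreover have "relative_drop m j * (m i / (m i - m (Suc j))) \<le> 2 * ((d (Suc j) - d j) / d (Suc j))"
        proof -
          have "relative_drop m j * (m i / (m i - m (Suc j))) = (m i / m j) * ((d (Suc j) - d j) / d (Suc j))"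
            by (simp add: relative_drop_def d_def)
          also have "\<dots> \<le> 2 * ((d (Suc j) - d j) / d (Suc j))"
            using h mj mjp by (intro mult_right_mono) (auto simp: d_def divide_simps)
          finally show ?thesis .
        qed
        ultimately have "a j * (relative_drop m j * (m i / (m i - m (Suc j)))) \<le>
           log_weight j * (2 * ((d (Suc j) - d j) / d (Suc j)))"
          by (rule mult_mono) (use log_weight_pos[of j] pos mi lt mj in \<open>auto intro: less_imp_le\<close>)
        then have "a j * relative_drop m j * (m i / (m i - m (Suc j))) \<le>
           2 * (log_weight j * ((d (Suc j) - d j) / d (Suc j)))"
          by (simp only: ac_simps)
        then show ?thesis using True aq0 by simp
      qed
    qed
  qed
  then have "(\<Sum>j=i..<N. a j * relative_drop m j * (m i / (m i - m (Suc j)))) \<le>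
    (\<Sum>j=i..<N. 2 * (a j * relative_drop m j) +
     2 * (if S j then log_weight j * ((d (Suc j) - d j) / d (Suc j)) else 0))"
    by (intro sum_mono) auto
  also have "\<dots> = 2 * (\<Sum>j=i..<N. a j * relative_drop m j) +
     2 * (\<Sum>j=i..<N. if S j then log_weight j * ((d (Suc j) - d j) / d (Suc j)) else 0)"
    by (simp only: sum.distrib sum_distrib_left)
  also have "\<dots> \<le> 2 * 2 + 2 * 2"
  proof -
    have "(\<Sum>j=i..<N. if S j then log_weight j * ((d (Suc j) - d j) / d (Suc j)) else 0) \<le> 2"
    proof (rule log_weighted_increments_bound[where K = "m i / 2"])
      show "incseq d" using dec by (auto simp: d_def incseq_def decseq_def)
      show "0 \<le> d j" if "i \<le> j" for j using that dec by (auto simp: d_def decseq_def)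
      show "0 < m i / 2" using mi by simp
      fix j assume j: "i \<le> j" "S j"
      have mj: "m (Suc j) \<le> m j" "m j \<le> m i" using j dec by (auto intro: decseqD)
      have h: "m i / 2 < m (Suc j)" "1 / (real j + 1)\<^sup>2 \<le> relative_drop m j" using j(2) by (auto simp: S_def)
      \<comment> \<open>Because \<open>m j\<close> is at least \<open>m i / 2\<close>, one counted
        drop alone lifts \<open>d (Suc j)\<close> to \<open>K / (j + 1)^2\<close> with
        \<open>K = m i / 2\<close>.\<close>
      have "m i / 2 / (real j + 1)\<^sup>2 = (m i / 2) * (1 / (real j + 1)\<^sup>2)" by simp
      also have "\<dots> \<le> m j * relative_drop m j"
        using h mj mi by (intro mult_mono) auto
      also have "\<dots> = m j - m (Suc j)" using h mj mi by (simp add: relative_drop_def)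
      also have "\<dots> \<le> d (Suc j)" using mj by (simp add: d_def)
      finally show "d (Suc j) < m i / 2 \<and> m i / 2 / (real j + 1)\<^sup>2 \<le> d (Suc j)"
        using h by (simp add: d_def)
    qed
    then show ?thesis using sum by linarith
  qed
  finally show ?thesis by simp
qed

section \<open>Divergence of the weighted drops along a single path\<close>

text \<open>Summation by parts: each decrease of \<open>w\<close> multiplies a partial sum of
  \<open>x\<close>, so it costs at most \<open>K\<close> times that decrease. The induction keeps
  track of the last partial sum as well.\<close>

lemma weighted_sum_lower_bound:
  fixes x w :: "nat \<Rightarrow> real"
  assumes w: "\<And>n. w (Suc n) \<le> w n" "\<And>n. 0 \<le> w n"
    and X: "\<And>n. - K \<le> (\<Sum>k<n. x k)"
  shows "- K * w 0 \<le> (\<Sum>k<n. x k * w k)"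
proof -
  have "(\<Sum>k<n. x k) * w n - K * (w 0 - w n) \<le> (\<Sum>k<n. x k * w k)"
  proof (induction n)
    case (Suc n)
    have "0 \<le> ((\<Sum>k<Suc n. x k) + K) * (w n - w (Suc n))"
      using X[of "Suc n"] w(1)[of n] by (intro mult_nonneg_nonneg) auto
    with Suc show ?case by (simp add: algebra_simps)
  qed simp
  moreover have "- K * w n \<le> (\<Sum>k<n. x k) * w n"
    using X w(2) by (rule mult_right_mono)
  ultimately show ?thesis by (simp add: algebra_simps)
qed

text \<open>The logarithmic decrease \<open>- ln (1 - q)\<close> is split by the size of
  \<open>q\<close>. Large drops (\<open>e1\<close>) are finitely many, drops below
  \<open>1 / (k + 1)^2\<close> (\<open>e2\<close>) are summable, and the remaining ones are at most
  \<open>r k = 2 * q\<close>, by \<open>- ln (1 - q) <= 2 * q\<close> for \<open>q < 1/2\<close>.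
  The first two kinds and \<open>ln (m 0)\<close> go into \<open>K\<close>.\<close>

lemma drop_weights_dominate_log_drops:
  assumes dec: "decseq m" and pos: "\<And>n. 0 < m n"
    and sm: "summable (\<lambda>n. drop_weight n (relative_drop m n) * relative_drop m n)"
  obtains r K where "\<And>k. 0 \<le> r k"
    and "\<And>k. r k * log_weight k \<le> 2 * (drop_weight k (relative_drop m k) * relative_drop m k)"
    and "\<And>n. - ln (m n) \<le> (\<Sum>k<n. r k) + K"
proof -
  let ?q = "relative_drop m"
  have q0: "0 \<le> ?q k" for k using dec pos by (intro relative_drop_nonneg) (auto intro: less_imp_le)
  have q1: "1 - ?q k = m (Suc k) / m k" for k
    using pos[of k] by (simp add: relative_drop_def field_simps)
  define r where "r k = (if 1 / (real k + 1)\<^sup>2 \<le> ?q k \<and> ?q k < 1/2 then 2 * ?q k else 0)" for k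
  define e1 where "e1 k = (if 1/2 \<le> ?q k then - ln (1 - ?q k) else 0)" for k
  define e2 where "e2 k = 2 / (real k + 1)\<^sup>2" for k :: nat
  have "(\<lambda>n. drop_weight n (?q n) * ?q n) \<longlonglongrightarrow> 0" by (rule summable_LIMSEQ_zero[OF sm])
  then have "eventually (\<lambda>n. drop_weight n (?q n) * ?q n < 1/2) sequentially"
    by (rule order_tendstoD) simp
  \<comment> \<open>Drops of at least \<open>1/2\<close> carry weight \<open>1\<close>; as the
    weighted drops tend to \<open>0\<close>, only finitely many such drops occur.\<close>
  then have "eventually (\<lambda>n. e1 n = 0) sequentially"
    by eventually_elim (auto simp: e1_def drop_weight_def)
  then have sm1: "summable e1"
    using summable_cong[of e1 "\<lambda>_. 0"] by simp
  have sm2: "summable e2"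
  proof -
    have "summable (\<lambda>n. 2 * (1 / (real (Suc n))\<^sup>2))"
      using inverse_squares_sums by (intro summable_mult) (auto simp: sums_iff add.commute)
    then show ?thesis by (simp add: e2_def [abs_def] add.commute)
  qed
  have e0: "0 \<le> e1 k" "0 \<le> e2 k" for k
  proof -
    have "0 < 1 - ?q k" unfolding q1 using pos by simp
    moreover have "1 - ?q k \<le> 1" using q0[of k] by simp
    ultimately have "ln (1 - ?q k) \<le> 0" by simp
    then show "0 \<le> e1 k" by (simp add: e1_def)
  qed (simp add: e2_def)
  have r0: "0 \<le> r k" for k using q0 by (simp add: r_def)
  have step: "ln (m k) - ln (m (Suc k)) \<le> r k + (e1 k + e2 k)" for k
  proof -
    have "0 < 1 - ?q k" unfolding q1 using pos by simp
    have "ln (1 - ?q k) = ln (m (Suc k)) - ln (m k)"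
      unfolding q1 using pos[of k] pos[of "Suc k"] by (simp add: ln_div)
    moreover have "- ln (1 - ?q k) \<le> r k + (e1 k + e2 k)"
    proof (cases "1/2 \<le> ?q k")
      case True then show ?thesis using e0[of k] r0[of k] by (simp add: e1_def)
    next
      case False
      have "ln (1 / (1 - ?q k)) \<le> 1 / (1 - ?q k) - 1"
        using \<open>0 < 1 - ?q k\<close> by (intro ln_le_minus_one) simp
      also have "\<dots> = ?q k / (1 - ?q k)" using \<open>0 < 1 - ?q k\<close> by (simp add: field_simps)
      also have "\<dots> \<le> ?q k / (1/2)" using False q0[of k] by (intro divide_left_mono) auto
      finally have "- ln (1 - ?q k) \<le> 2 * ?q k" using \<open>0 < 1 - ?q k\<close> by (simp add: ln_div)
      moreover have "2 * ?q k \<le> r k + e2 k"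
        using False e0(2)[of k] by (auto simp: r_def e2_def)
      ultimately show ?thesis using e0[of k] by simp
    qed
    ultimately show ?thesis by simp
  qed
  have sm12: "summable (\<lambda>k. e1 k + e2 k)" using sm1 sm2 by (rule summable_add)
  show ?thesis
  proof
    show "0 \<le> r k" for k by (rule r0)
    show "r k * log_weight k \<le> 2 * (drop_weight k (?q k) * ?q k)" for k
      using q0[of k] drop_weight_nonneg[of k "?q k"] by (auto simp: r_def drop_weight_def)
    fix n
    have "ln (m 0) - ln (m n) = (\<Sum>k<n. ln (m k) - ln (m (Suc k)))"
      by (rule sum_lessThan_telescope'[symmetric])
    also have "\<dots> \<le> (\<Sum>k<n. r k) + (\<Sum>k<n. e1 k + e2 k)"
      unfolding sum.distrib[symmetric] using step by (intro sum_mono) (simp add: add.assoc)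
    also have "(\<Sum>k<n. e1 k + e2 k) \<le> (\<Sum>k. e1 k + e2 k)"
      using sm12 e0 by (intro sum_le_suminf) auto
    finally show "- ln (m n) \<le> (\<Sum>k<n. r k) + ((\<Sum>k. e1 k + e2 k) - ln (m 0))"
      by simp
  qed
qed

text \<open>The factor \<open>3\<close> absorbs the three terms of \<open>1 + ln 2 + ln k\<close>,
  each of which is at most \<open>max 1 (ln x)\<close>.\<close>

lemma log_weight_bound:
  assumes "real k \<le> x"
  shows "1 / max 1 (ln x) \<le> 3 * log_weight k"
proof -
  have "1 + ln (real k + 1) \<le> 3 * max 1 (ln x)"
  proof (cases k)
    case 0 then show ?thesis by simp
  next
    case (Suc j)
    then have x: "0 < real k" "1 \<le> real k" using assms by auto
    have "ln (real k + 1) \<le> ln (2 * real k)" using x by (subst ln_le_cancel_iff) auto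
    also have "\<dots> = ln 2 + ln (real k)" using x by (simp add: ln_mult)
    also have "ln (2::real) \<le> 1" using ln_2_less_1 by simp
    also have "ln (real k) \<le> ln x" using x assms by (subst ln_le_cancel_iff) auto
    finally show ?thesis by linarith
  qed
  moreover have "0 < 1 + ln (real k + 1)" by (simp add: add_pos_nonneg)
  ultimately show ?thesis by (simp add: log_weight_def divide_simps)
qed

text \<open>The series is cut into blocks, one for each unit step of the argument of \<phi>. In the
  block belonging to \<open>[n, n + 1]\<close> every inverse value is at least \<open>n\<close>, so
  every term is at most \<open>3 * log_weight n\<close>.\<close>

lemma sum_inverse_le_sum_log_weight:
  assumes phi_mono: "strict_mono_on {0..} \<phi>" and phi_bij: "bij_betw \<phi> {0..} {0..}"
  shows "(\<Sum>j<nat \<lfloor>\<phi> (real n)\<rfloor>. 1 / max 1 (ln (inv_into {0..} \<phi> (real (Suc j)))))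
    \<le> (\<Sum>j<nat \<lfloor>\<phi> 0\<rfloor>. 1 / max 1 (ln (inv_into {0..} \<phi> (real (Suc j)))))
      + 3 * (\<Sum>k<n. (real (nat \<lfloor>\<phi> (real (Suc k))\<rfloor>) - real (nat \<lfloor>\<phi> (real k)\<rfloor>)) * log_weight k)"
proof (induction n)
  case 0
  show ?case by simp
next
  case (Suc n)
  let ?v = "\<lambda>j. 1 / max 1 (ln (inv_into {0..} \<phi> (real (Suc j))))"
  define A where "A k = nat \<lfloor>\<phi> (real k)\<rfloor>" for k :: nat
  have "\<phi> (real n) < \<phi> (real (Suc n))" using phi_mono by (rule strict_mono_onD) auto
  then have AA: "A n \<le> A (Suc n)" unfolding A_def by (intro nat_mono floor_mono) simp
  have v: "?v j \<le> 3 * log_weight n" if "j \<in> {A n..<A (Suc n)}" for j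
  proof (rule log_weight_bound)
    \<comment> \<open>From \<open>j\<close> being at least the floor of \<open>\<phi> n\<close> it
      follows that \<open>\<phi> n < j + 1\<close>, so the inverse at \<open>j + 1\<close> is at
      least the left end \<open>n\<close> of the block.\<close>
    have j: "\<phi> (real n) < real (Suc j)" using that by (simp add: A_def) linarith
    have im: "real (Suc j) \<in> \<phi> ` {0..}" using phi_bij by (simp add: bij_betw_def)
    then have i: "inv_into {0..} \<phi> (real (Suc j)) \<in> {0..}" "\<phi> (inv_into {0..} \<phi> (real (Suc j))) = real (Suc j)"
      by (rule inv_into_into, rule f_inv_into_f)
    show "real n \<le> inv_into {0..} \<phi> (real (Suc j))"
    proof (rule ccontr)
      assume "\<not> ?thesis"
      then have "\<phi> (inv_into {0..} \<phi> (real (Suc j))) < \<phi> (real n)"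
        using i by (intro strict_mono_onD[OF phi_mono]) auto
      then show False using i j by simp
    qed
  qed
  have "(\<Sum>j<A (Suc n). ?v j) = (\<Sum>j<A n. ?v j) + (\<Sum>j\<in>{A n..<A (Suc n)}. ?v j)"
    unfolding lessThan_atLeast0
    by (rule sum.atLeastLessThan_concat[symmetric]) (use AA in auto)
  also have "(\<Sum>j\<in>{A n..<A (Suc n)}. ?v j) \<le> (\<Sum>j\<in>{A n..<A (Suc n)}. 3 * log_weight n)"
    using v by (rule sum_mono)
  also have "\<dots> = 3 * ((real (A (Suc n)) - real (A n)) * log_weight n)"
    using AA by (simp add: of_nat_diff)
  finally show ?case using Suc unfolding A_def[symmetric] by simp
qed

text \<open>If the sum were finite, \<open>- ln (m n)\<close> would be controlled by the sum of
  \<open>r\<close>. The hypothesis on \<open>y\<close> makes \<open>- ln (m n)\<close> at least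
  \<open>\<phi> n - ln C\<close>, so the increments of \<phi> are dominated by \<open>r\<close> up
  to a constant. Summation by parts carries this over to the \<open>log_weight\<close>-weighted
  sums, and the block estimate then bounds the divergent series.\<close>

lemma not_summable_weighted_drops:
  fixes y :: "nat \<Rightarrow> real"
  assumes pos: "\<And>n. 0 < y n" and bd: "\<And>n. y n * exp (\<phi> (real n)) \<le> C"
    and phi_mono: "strict_mono_on {0..} \<phi>" and phi_bij: "bij_betw \<phi> {0..} {0..}"
    and phi_div: "\<not> summable (\<lambda>n. 1 / max 1 (ln (inv_into {0..} \<phi> (real (Suc n)))))"
  shows "\<not> summable (\<lambda>n. drop_weight n (relative_drop (running_min y) n) * relative_drop (running_min y) n)"
proof
  let ?m = "running_min y" and ?v = "\<lambda>j. 1 / max 1 (ln (inv_into {0..} \<phi> (real (Suc j))))"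
  let ?f = "\<lambda>n. drop_weight n (relative_drop ?m n) * relative_drop ?m n"
  assume sm: "summable ?f"
  have mpos: "0 < ?m n" for n using pos by (rule running_min_pos)
  have q0: "0 \<le> relative_drop ?m k" for k
    using decseq_running_min mpos by (intro relative_drop_nonneg) (auto intro: less_imp_le)
  obtain r K where r: "\<And>k. 0 \<le> r k" "\<And>k. r k * log_weight k \<le> 2 * ?f k"
      "\<And>n. - ln (?m n) \<le> (\<Sum>k<n. r k) + K"
    using drop_weights_dominate_log_drops[OF decseq_running_min mpos sm] by metis
  \<comment> \<open>\<open>t k\<close> is the number of integers in the interval from
    \<open>\<phi> k\<close> (excluded) to \<open>\<phi> (k + 1)\<close> (included), that is, the
    length of block \<open>k\<close>.\<close>
  define t where "t k = real (nat \<lfloor>\<phi> (real (Suc k))\<rfloor>) - real (nat \<lfloor>\<phi> (real k)\<rfloor>)" for k :: nat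
  have phi0: "0 \<le> \<phi> x" if "0 \<le> x" for x using phi_bij that by (auto simp: bij_betw_def)
  have "- (K + ln C) \<le> (\<Sum>k<n. r k - t k)" for n
  proof -
    have "(\<Sum>k<n. t k) = real (nat \<lfloor>\<phi> (real n)\<rfloor>) - real (nat \<lfloor>\<phi> (real 0)\<rfloor>)"
      unfolding t_def by (rule sum_lessThan_telescope)
    also have "\<dots> \<le> \<phi> (real n)" using phi0[of "real n"] by (simp add: of_nat_nat) linarith
    also have "\<phi> (real n) \<le> ln C - ln (?m n)"
    proof -
      have "?m n * exp (\<phi> (real n)) \<le> y n * exp (\<phi> (real n))"
        by (intro mult_right_mono running_min_le) auto
      also have "\<dots> \<le> C" by (rule bd)
      finally have le: "?m n * exp (\<phi> (real n)) \<le> C" .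
      moreover have "0 < ?m n * exp (\<phi> (real n))" using mpos by simp
      ultimately have "ln (?m n * exp (\<phi> (real n))) \<le> ln C"
        by (subst ln_le_cancel_iff) auto
      then show ?thesis using mpos[of n] by (simp add: ln_mult)
    qed
    also have "\<dots> \<le> ln C + ((\<Sum>k<n. r k) + K)" using r(3)[of n] by simp
    finally show ?thesis by (simp add: sum_subtractf)
  qed
  then have abel: "- (K + ln C) * log_weight 0 \<le> (\<Sum>k<n. (r k - t k) * log_weight k)" for n
    using log_weight_antimono log_weight_pos
    by (intro weighted_sum_lower_bound) (auto intro: less_imp_le)
  have T: "(\<Sum>k<n. t k * log_weight k) \<le> 2 * (\<Sum>k. ?f k) + (K + ln C) * log_weight 0" for n
  proof -
    have "(\<Sum>k<n. r k * log_weight k) \<le> (\<Sum>k<n. 2 * ?f k)" using r(2) by (rule sum_mono)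
    also have "\<dots> = 2 * (\<Sum>k<n. ?f k)" by (simp add: sum_distrib_left)
    also have "(\<Sum>k<n. ?f k) \<le> (\<Sum>k. ?f k)"
      using sm q0 drop_weight_nonneg by (intro sum_le_suminf) auto
    finally have "(\<Sum>k<n. r k * log_weight k) \<le> 2 * (\<Sum>k. ?f k)" by simp
    moreover have "(\<Sum>k<n. (r k - t k) * log_weight k) =
        (\<Sum>k<n. r k * log_weight k) - (\<Sum>k<n. t k * log_weight k)"
      by (simp only: left_diff_distrib sum_subtractf)
    ultimately show ?thesis using abel[of n] unfolding minus_mult_left[symmetric] by linarith
  qed
  have "(\<Sum>j<N. ?v j) \<le> (\<Sum>j<nat \<lfloor>\<phi> 0\<rfloor>. ?v j) + 3 * (2 * (\<Sum>k. ?f k) + (K + ln C) * log_weight 0)" for N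
  proof -
    \<comment> \<open>This \<open>n\<close> satisfies \<open>N <= \<phi> n\<close>, so the blocks
      before \<open>n\<close>, with the initial segment, cover all indices below
      \<open>N\<close>.\<close>
    define n where "n = nat \<lceil>inv_into {0..} \<phi> (real N)\<rceil>"
    have im: "real N \<in> \<phi> ` {0..}" using phi_bij by (simp add: bij_betw_def)
    then have i: "inv_into {0..} \<phi> (real N) \<in> {0..}" "\<phi> (inv_into {0..} \<phi> (real N)) = real N"
      by (rule inv_into_into, rule f_inv_into_f)
    have "inv_into {0..} \<phi> (real N) \<le> real n" unfolding n_def by linarith
    then have "real N \<le> \<phi> (real n)"
      using i strict_mono_on_leD[OF phi_mono, of "inv_into {0..} \<phi> (real N)" "real n"] by auto
    then have "N \<le> nat \<lfloor>\<phi> (real n)\<rfloor>" by (simp add: le_nat_floor)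
    then have "(\<Sum>j<N. ?v j) \<le> (\<Sum>j<nat \<lfloor>\<phi> (real n)\<rfloor>. ?v j)"
      by (intro sum_mono2) auto
    also have "\<dots> \<le> (\<Sum>j<nat \<lfloor>\<phi> 0\<rfloor>. ?v j) + 3 * (\<Sum>k<n. t k * log_weight k)"
      unfolding t_def by (rule sum_inverse_le_sum_log_weight[OF phi_mono phi_bij])
    also have "\<dots> \<le> (\<Sum>j<nat \<lfloor>\<phi> 0\<rfloor>. ?v j) + 3 * (2 * (\<Sum>k. ?f k) + (K + ln C) * log_weight 0)"
      using T[of n] by (intro add_left_mono mult_left_mono) auto
    finally show ?thesis .
  qed
  then have "summable ?v" by (intro summableI_nonneg_bounded) auto
  with phi_div show False by contradiction
qed

section \<open>Integral comparisons and equality of conditional means\<close>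

lemma (in prob_space) integrable_bounded:
  fixes f :: "'a \<Rightarrow> real"
  assumes "f \<in> borel_measurable M" "\<And>\<omega>. \<bar>f \<omega>\<bar> \<le> C"
  shows "integrable M f"
  using assms by (intro integrable_const_bound[of f C]) auto

text \<open>Testing with the event \<open>g < f\<close>, which belongs to \<open>F\<close>, gives a
  nonnegative integrand whose integral is at most \<open>0\<close>.\<close>

lemma (in prob_space) AE_le_if_integral_le:
  fixes f g :: "'a \<Rightarrow> real"
  assumes sub: "subalgebra M F" and f: "f \<in> borel_measurable F" and g: "g \<in> borel_measurable F"
    and int: "integrable M f" "integrable M g"
    and le: "\<And>B. B \<in> sets F \<Longrightarrow> (\<integral>\<omega>. indicator B \<omega> * f \<omega> \<partial>M) \<le> (\<integral>\<omega>. indicator B \<omega> * g \<omega> \<partial>M)"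
  shows "AE \<omega> in M. f \<omega> \<le> g \<omega>"
proof -
  define B where "B = {\<omega> \<in> space F. g \<omega> < f \<omega>}"
  have B: "B \<in> sets F" unfolding B_def using f g by measurable
  then have BM[measurable]: "B \<in> sets M" using sub by (auto simp: subalgebra_def)
  have [measurable]: "f \<in> borel_measurable M" "g \<in> borel_measurable M"
    using sub f g by (auto intro: measurable_from_subalg)
  have i: "integrable M (\<lambda>\<omega>. indicator B \<omega> * f \<omega>)" "integrable M (\<lambda>\<omega>. indicator B \<omega> * g \<omega>)"
    using integrable_real_mult_indicator[OF BM int(1)] integrable_real_mult_indicator[OF BM int(2)]
    by (simp_all add: mult.commute)
  have int_h: "integrable M (\<lambda>\<omega>. indicator B \<omega> * f \<omega> - indicator B \<omega> * g \<omega>)"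
    using i by simp
  have pos: "0 \<le> indicator B \<omega> * f \<omega> - indicator B \<omega> * g \<omega>" for \<omega>
    by (auto simp: B_def indicator_def)
  have "(\<integral>\<omega>. indicator B \<omega> * f \<omega> - indicator B \<omega> * g \<omega> \<partial>M) \<le> 0"
    using le[OF B] i by simp
  then have "(\<integral>\<omega>. indicator B \<omega> * f \<omega> - indicator B \<omega> * g \<omega> \<partial>M) = 0"
    using pos by (intro antisym integral_nonneg_AE) auto
  then have "AE \<omega> in M. indicator B \<omega> * f \<omega> - indicator B \<omega> * g \<omega> = 0"
    using int_h pos by (subst (asm) integral_nonneg_eq_0_iff_AE) auto
  then show ?thesis
  proof (rule AE_mp[OF _ AE_I2], intro impI)
    fix \<omega> assume "\<omega> \<in> space M" "indicator B \<omega> * f \<omega> - indicator B \<omega> * g \<omega> = 0"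
    moreover have "space F = space M" using sub by (simp add: subalgebra_def)
    ultimately show "f \<omega> \<le> g \<omega>" by (auto simp: B_def indicator_def split: if_splits)
  qed
qed

text \<open>Equality of the conditional expectations of \<open>g\<close> and \<open>g'\<close> given
  \<open>F\<close>, expressed by bounded test functions. This is the form in which one factor is
  exchanged for another inside an integral.\<close>

definition (in prob_space) same_cond_mean ::
  "'a measure \<Rightarrow> ('a \<Rightarrow> real) \<Rightarrow> ('a \<Rightarrow> real) \<Rightarrow> bool" where
  "same_cond_mean F g g' \<longleftrightarrow> (\<forall>f C. f \<in> borel_measurable F \<longrightarrow> (\<forall>\<omega>. \<bar>f \<omega>\<bar> \<le> C) \<longrightarrow>
    (\<integral>\<omega>. f \<omega> * g \<omega> \<partial>M) = (\<integral>\<omega>. f \<omega> * g' \<omega> \<partial>M))"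

lemma (in prob_space) same_cond_meanD:
  fixes f :: "'a \<Rightarrow> real"
  assumes "same_cond_mean F g g'" "f \<in> borel_measurable F" "\<And>\<omega>. \<bar>f \<omega>\<bar> \<le> C"
  shows "(\<integral>\<omega>. f \<omega> * g \<omega> \<partial>M) = (\<integral>\<omega>. f \<omega> * g' \<omega> \<partial>M)"
  using assms unfolding same_cond_mean_def by blast

text \<open>The conditional expectation of the indicator lies between \<open>0\<close> and
  \<open>1\<close> only almost everywhere; truncating it makes the bounds hold at every point
  without changing any integral.\<close>

lemma (in prob_space) conditional_probability_exists:
  assumes sub: "subalgebra M F" and E[measurable]: "E \<in> sets M"
  obtains p :: "'a \<Rightarrow> real" where "p \<in> borel_measurable F" "\<And>\<omega>. 0 \<le> p \<omega>" "\<And>\<omega>. p \<omega> \<le> 1"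
    "same_cond_mean F p (indicator E)"
proof -
  interpret finite_measure_subalgebra M F by unfold_locales (rule sub)
  define p0 where "p0 = real_cond_exp M F (indicator E)"
  have p0[measurable]: "p0 \<in> borel_measurable F" unfolding p0_def by simp
  have "AE \<omega> in M. 0 \<le> p0 \<omega>" unfolding p0_def by (rule real_cond_exp_pos) auto
  moreover have "AE \<omega> in M. p0 \<omega> \<le> 1" unfolding p0_def
    by (rule real_cond_exp_le_c) (auto intro!: integrable_bounded[of _ 1] simp: indicator_def)
  ultimately have ae: "AE \<omega> in M. max 0 (min 1 (p0 \<omega>)) = p0 \<omega>" by eventually_elim auto
  show ?thesis
  proof
    show m: "(\<lambda>\<omega>. max 0 (min 1 (p0 \<omega>))) \<in> borel_measurable F" by simp
    show "0 \<le> max 0 (min 1 (p0 \<omega>))" "max 0 (min 1 (p0 \<omega>)) \<le> 1" for \<omega> by auto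
    show "same_cond_mean F (\<lambda>\<omega>. max 0 (min 1 (p0 \<omega>))) (indicator E)"
      unfolding same_cond_mean_def
    proof (intro allI impI)
      fix f :: "'a \<Rightarrow> real" and C assume f: "f \<in> borel_measurable F" "\<forall>\<omega>. \<bar>f \<omega>\<bar> \<le> C"
      have [measurable]: "f \<in> borel_measurable M" "(\<lambda>\<omega>. max 0 (min 1 (p0 \<omega>))) \<in> borel_measurable M"
          "p0 \<in> borel_measurable M"
        using f(1) m p0 by (auto intro: measurable_from_subalg[OF sub])
      have "0 \<le> C" using f(2) abs_ge_zero order_trans by blast
      then have "integrable M (\<lambda>\<omega>. f \<omega> * indicator E \<omega>)"
        using f by (intro integrable_bounded[of _ C]) (auto simp: indicator_def)
      then have "(\<integral>\<omega>. f \<omega> * p0 \<omega> \<partial>M) = (\<integral>\<omega>. f \<omega> * indicator E \<omega> \<partial>M)"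
        unfolding p0_def using f(1) by (intro real_cond_exp_intg) auto
      moreover have "(\<integral>\<omega>. f \<omega> * max 0 (min 1 (p0 \<omega>)) \<partial>M) = (\<integral>\<omega>. f \<omega> * p0 \<omega> \<partial>M)"
        using ae by (intro integral_cong_AE) auto
      ultimately show "(\<integral>\<omega>. f \<omega> * max 0 (min 1 (p0 \<omega>)) \<partial>M) = (\<integral>\<omega>. f \<omega> * indicator E \<omega> \<partial>M)"
        by simp
    qed
  qed
qed

section \<open>Escapes of a supermartingale with values in the unit interval, and the maximal
  inequality\<close>

locale unit_supermartingale = prob_space M for M :: "'w measure" +
  fixes F :: "nat \<Rightarrow> 'w measure" and Y :: "nat \<Rightarrow> 'w \<Rightarrow> real"
  assumes subalg: "subalgebra M (F n)"
    and sets_F_Suc: "sets (F n) \<subseteq> sets (F (Suc n))"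
    and Y_measurable_F: "Y n \<in> borel_measurable (F n)"
    and Y_nonneg: "0 \<le> Y n \<omega>" and Y_le_1: "Y n \<omega> \<le> 1"
    and supermartingale: "B \<in> sets (F n) \<Longrightarrow>
      (\<integral>\<omega>. indicator B \<omega> * Y (Suc n) \<omega> \<partial>M) \<le> (\<integral>\<omega>. indicator B \<omega> * Y n \<omega> \<partial>M)"
begin

definition low :: "nat \<Rightarrow> 'w \<Rightarrow> real" where
  "low n \<omega> = running_min (\<lambda>k. Y k \<omega>) n"

definition drop_at :: "nat \<Rightarrow> 'w \<Rightarrow> real" where
  "drop_at n \<omega> = relative_drop (running_min (\<lambda>k. Y k \<omega>)) n"

text \<open>Escape up to time \<open>j\<close>: for \<open>i <= j\<close> it is an event of
  \<open>F j\<close>, while \<open>escape i\<close> depends on the whole future. For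
  \<open>j <= i\<close> the condition is vacuous.\<close>

definition stays_below :: "nat \<Rightarrow> nat \<Rightarrow> 'w set" where
  "stays_below i j = {\<omega> \<in> space M. \<forall>s\<in>{i<..j}. Y s \<omega> < low i \<omega>}"

definition escape :: "nat \<Rightarrow> 'w set" where
  "escape i = {\<omega> \<in> space M. \<forall>s>i. Y s \<omega> < low i \<omega>}"

lemma space_F: "space (F n) = space M"
  using subalg by (simp add: subalgebra_def)

lemma subalg_F: "i \<le> j \<Longrightarrow> subalgebra (F j) (F i)"
  unfolding subalgebra_def space_F using sets_F_Suc
  by (auto simp: lift_Suc_mono_le[of "\<lambda>n. sets (F n)", THEN subsetD])

lemma measurable_F_mono: "f \<in> measurable (F i) N \<Longrightarrow> i \<le> j \<Longrightarrow> f \<in> measurable (F j) N"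
  using subalg_F measurable_from_subalg by blast

lemma measurable_F_M: "f \<in> measurable (F i) N \<Longrightarrow> f \<in> measurable M N"
  using subalg measurable_from_subalg by blast

lemma sets_F_mono: "B \<in> sets (F i) \<Longrightarrow> i \<le> j \<Longrightarrow> B \<in> sets (F j)"
  using subalg_F by (auto simp: subalgebra_def)

lemma sets_F_M: "B \<in> sets (F i) \<Longrightarrow> B \<in> sets M"
  using subalg by (auto simp: subalgebra_def)

lemma Y_measurable[measurable]: "i \<le> j \<Longrightarrow> Y i \<in> borel_measurable (F j)"
  using Y_measurable_F measurable_F_mono by blast

lemma low_0: "low 0 \<omega> = Y 0 \<omega>"
  and low_Suc: "low (Suc n) \<omega> = min (low n \<omega>) (Y (Suc n) \<omega>)"
  by (simp_all add: low_def)

lemma low_measurable[measurable]: "i \<le> j \<Longrightarrow> low i \<in> borel_measurable (F j)"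
proof (induction i)
  case 0
  have "low 0 = Y 0" by (auto simp: low_0)
  then show ?case using Y_measurable[of 0 j] by simp
next
  case (Suc i)
  have "low (Suc i) = (\<lambda>\<omega>. min (low i \<omega>) (Y (Suc i) \<omega>))" by (auto simp: low_Suc)
  then show ?case using Suc by simp
qed

lemma low_nonneg: "0 \<le> low n \<omega>"
  unfolding low_def by (rule running_min_nonneg) (rule Y_nonneg)

lemma low_le_1: "low n \<omega> \<le> 1"
  unfolding low_def using running_min_le[of n n "\<lambda>k. Y k \<omega>"] Y_le_1[of n \<omega>] by simp

lemma low_decseq: "i \<le> j \<Longrightarrow> low j \<omega> \<le> low i \<omega>"
  unfolding low_def by (rule decseqD[OF decseq_running_min])

lemma drop_at_eq: "drop_at n \<omega> = (low n \<omega> - low (Suc n) \<omega>) / low n \<omega>"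
  by (simp add: drop_at_def low_def relative_drop_def)

lemma drop_at_nonneg: "0 \<le> drop_at n \<omega>"
  unfolding drop_at_eq using low_decseq[of n "Suc n" \<omega>] low_nonneg[of n \<omega>] by simp

lemma drop_at_le_1: "drop_at n \<omega> \<le> 1"
  unfolding drop_at_def
  using low_nonneg unfolding low_def by (rule relative_drop_le_1)

lemma drop_at_measurable[measurable]: "i < j \<Longrightarrow> drop_at i \<in> borel_measurable (F j)"
  unfolding drop_at_eq[abs_def] by measurable

lemma stays_below_sets[measurable]: "j \<le> k \<Longrightarrow> i \<le> k \<Longrightarrow> stays_below i j \<in> sets (F k)"
  unfolding stays_below_def space_F[of k, symmetric] by measurable

lemma Y_measurable_M[measurable]: "Y i \<in> borel_measurable M"
  and low_measurable_M[measurable]: "low i \<in> borel_measurable M"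
  and drop_at_measurable_M[measurable]: "drop_at i \<in> borel_measurable M"
  and stays_below_sets_M[measurable]: "stays_below i j \<in> sets M"
  using measurable_F_M[OF Y_measurable[of i i]] measurable_F_M[OF low_measurable[of i i]]
    measurable_F_M[OF drop_at_measurable[of i "Suc i"]]
    sets_F_M[OF stays_below_sets[of j "max i j" i]] by auto

lemma escape_sets[measurable]: "escape i \<in> sets M"
  unfolding escape_def by measurable

lemma escape_eq: "escape i = (\<Inter>j. stays_below i j)"
  by (fastforce simp: escape_def stays_below_def)

text \<open>Doob's maximal inequality for the supermartingale after time \<open>j\<close>, stopped when it returns
  to the level \<open>low i\<close>.\<close>

lemma escape_integral_ge:
  assumes ij: "i \<le> j" and B: "B \<in> sets (F j)"
  shows "(\<integral>\<omega>. indicator B \<omega> * (indicator (stays_below i j) \<omega> * (low i \<omega> - Y j \<omega>)) \<partial>M)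
    \<le> (\<integral>\<omega>. indicator B \<omega> * (low i \<omega> * indicator (escape i) \<omega>) \<partial>M)"
proof -
  have BM[measurable]: "B \<in> sets M" using B by (rule sets_F_M)
  define D where "D k = B \<inter> stays_below i k" for k
  have DF: "D k \<in> sets (F k)" if "j \<le> k" for k
    unfolding D_def using sets_F_mono[OF B that] stays_below_sets[of k k i] that ij by auto
  have [measurable]: "D k \<in> sets M" for k unfolding D_def by simp
  define G where "G k = (\<integral>\<omega>. indicator (D k) \<omega> * (low i \<omega> - Y k \<omega>) \<partial>M)" for k
  have intY: "integrable M (\<lambda>\<omega>. indicator S \<omega> * Y k \<omega>)" if "S \<in> sets M" for S k
    using that Y_nonneg Y_le_1 by (intro integrable_bounded[of _ 1]) (auto simp: indicator_def)
  have intl: "integrable M (\<lambda>\<omega>. indicator S \<omega> * low i \<omega>)" if "S \<in> sets M" for S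
    using that low_nonneg low_le_1 by (intro integrable_bounded[of _ 1]) (auto simp: indicator_def)
  have G_Suc: "G k \<le> G (Suc k)" if k: "j \<le> k" for k
  proof -
    have "G k = (\<integral>\<omega>. indicator (D k) \<omega> * low i \<omega> \<partial>M) - (\<integral>\<omega>. indicator (D k) \<omega> * Y k \<omega> \<partial>M)"
      unfolding G_def right_diff_distrib using intY intl by simp
    also have "\<dots> \<le> (\<integral>\<omega>. indicator (D k) \<omega> * low i \<omega> \<partial>M) - (\<integral>\<omega>. indicator (D k) \<omega> * Y (Suc k) \<omega> \<partial>M)"
      using supermartingale[OF DF[OF k]] by simp
    also have "\<dots> = (\<integral>\<omega>. indicator (D k) \<omega> * low i \<omega> - indicator (D k) \<omega> * Y (Suc k) \<omega> \<partial>M)"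
      using intY intl by simp
    \<comment> \<open>On \<open>D k - D (Suc k)\<close> the process is back at \<open>low i\<close>
      or above, so the integrand is at most \<open>0\<close> there and discarding this part cannot
      lower the integral.\<close>
    also have "\<dots> \<le> (\<integral>\<omega>. indicator (D (Suc k)) \<omega> * low i \<omega> - indicator (D (Suc k)) \<omega> * Y (Suc k) \<omega> \<partial>M)"
    proof (rule integral_mono)
      fix \<omega> assume "\<omega> \<in> space M"
      then show "indicator (D k) \<omega> * low i \<omega> - indicator (D k) \<omega> * Y (Suc k) \<omega> \<le>
          indicator (D (Suc k)) \<omega> * low i \<omega> - indicator (D (Suc k)) \<omega> * Y (Suc k) \<omega>"
        using k ij by (auto simp: D_def stays_below_def indicator_def le_Suc_eq)
    qed (use intY intl in simp_all)
    also have "\<dots> = G (Suc k)" by (simp add: G_def right_diff_distrib)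
    finally show ?thesis .
  qed
  have mono: "G j \<le> G k" if "j \<le> k" for k
    using that by (induction k rule: dec_induct) (auto intro: order_trans G_Suc)
  have le: "G j \<le> (\<integral>\<omega>. indicator (D k) \<omega> * low i \<omega> \<partial>M)" if "j \<le> k" for k
  proof -
    have "G k \<le> (\<integral>\<omega>. indicator (D k) \<omega> * low i \<omega> \<partial>M)"
      unfolding G_def right_diff_distrib
      using intY intl Y_nonneg by (intro integral_mono) auto
    then show ?thesis using mono[OF that] by simp
  qed
  have "(\<lambda>k. \<integral>\<omega>. indicator (D k) \<omega> * low i \<omega> \<partial>M) \<longlonglongrightarrow>
      (\<integral>\<omega>. indicator B \<omega> * (low i \<omega> * indicator (escape i) \<omega>) \<partial>M)"
  proof (rule integral_dominated_convergence[where w = "\<lambda>_. 1"])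
    show "AE \<omega> in M. (\<lambda>k. indicator (D k) \<omega> * low i \<omega>) \<longlonglongrightarrow>
        indicator B \<omega> * (low i \<omega> * indicator (escape i) \<omega>)"
    proof (rule AE_I2)
      fix \<omega> assume w: "\<omega> \<in> space M"
      have "(\<lambda>k. indicator (D k) \<omega> :: real) \<longlonglongrightarrow> indicator (\<Inter>k. D k) \<omega>"
        by (rule LIMSEQ_indicator_decseq) (auto simp: decseq_def D_def stays_below_def)
      moreover have "(\<Inter>k. D k) = B \<inter> escape i" by (auto simp: D_def escape_eq)
      ultimately have "(\<lambda>k. indicator (D k) \<omega> * low i \<omega>) \<longlonglongrightarrow> indicator (B \<inter> escape i) \<omega> * low i \<omega>"
        by (intro tendsto_mult_right) simp
      then show "(\<lambda>k. indicator (D k) \<omega> * low i \<omega>) \<longlonglongrightarrow>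
        indicator B \<omega> * (low i \<omega> * indicator (escape i) \<omega>)"
        by (simp add: indicator_inter_arith ac_simps)
    qed
    show "AE \<omega> in M. norm (indicator (D k) \<omega> * low i \<omega>) \<le> 1" for k
      using low_nonneg low_le_1 by (auto simp: indicator_def)
  qed simp_all
  then have "G j \<le> (\<integral>\<omega>. indicator B \<omega> * (low i \<omega> * indicator (escape i) \<omega>) \<partial>M)"
    using le by (intro LIMSEQ_le_const) auto
  then show ?thesis by (simp add: G_def D_def indicator_inter_arith mult.assoc)
qed

text \<open>Since the integral inequality holds over every event of \<open>F j\<close>, it holds
  pointwise: while the path stays below, the escape probability given \<open>F j\<close> is at least
  \<open>1 - Y j / low i\<close>. Multiplying by \<open>low i\<close> covers the case
  \<open>low i = 0\<close>.\<close>

lemma escape_prob_ge: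
  assumes ij: "i \<le> j" and p: "p \<in> borel_measurable (F j)" "\<And>\<omega>. 0 \<le> p \<omega>" "\<And>\<omega>. p \<omega> \<le> 1"
    and cond: "same_cond_mean (F j) p (indicator (escape i))"
  shows "AE \<omega> in M. indicator (stays_below i j) \<omega> * (low i \<omega> - Y j \<omega>) \<le> low i \<omega> * p \<omega>"
proof (rule AE_le_if_integral_le[OF subalg[of j]])
  note [measurable] = p(1)
  have bound: "\<bar>low i \<omega> - Y j \<omega>\<bar> \<le> 1" for \<omega>
    using low_nonneg[of i \<omega>] low_le_1[of i \<omega>] Y_nonneg[of j \<omega>] Y_le_1[of j \<omega>] by linarith
  show m1: "(\<lambda>\<omega>. indicator (stays_below i j) \<omega> * (low i \<omega> - Y j \<omega>)) \<in> borel_measurable (F j)"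
    using ij by (intro borel_measurable_times borel_measurable_indicator stays_below_sets
        borel_measurable_diff low_measurable Y_measurable) auto
  show m2: "(\<lambda>\<omega>. low i \<omega> * p \<omega>) \<in> borel_measurable (F j)" using ij by measurable
  show "integrable M (\<lambda>\<omega>. indicator (stays_below i j) \<omega> * (low i \<omega> - Y j \<omega>))"
    using bound by (intro integrable_bounded[of _ 1] measurable_F_M[OF m1]) (auto simp: indicator_def)
  show "integrable M (\<lambda>\<omega>. low i \<omega> * p \<omega>)"
    using low_nonneg low_le_1 p
    by (intro integrable_bounded[of _ 1] measurable_F_M[OF m2]) (auto simp: abs_mult intro!: mult_le_one)
  fix B assume B[measurable]: "B \<in> sets (F j)"
  have "(\<integral>\<omega>. (indicator B \<omega> * low i \<omega>) * p \<omega> \<partial>M) = (\<integral>\<omega>. (indicator B \<omega> * low i \<omega>) * indicator (escape i) \<omega> \<partial>M)"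
    using low_nonneg low_le_1 ij by (intro same_cond_meanD[OF cond, of _ 1]) (auto simp: indicator_def)
  then show "(\<integral>\<omega>. indicator B \<omega> * (indicator (stays_below i j) \<omega> * (low i \<omega> - Y j \<omega>)) \<partial>M)
      \<le> (\<integral>\<omega>. indicator B \<omega> * (low i \<omega> * p \<omega>) \<partial>M)"
    using escape_integral_ge[OF ij B] by (simp add: mult.assoc)
qed

end

section \<open>Second moment method for weighted escapes\<close>

text \<open>Adding terms only until the total reaches \<open>1\<close> overshoots by at most one
  term, hence by at most \<open>1\<close>.\<close>

lemma stopped_sum_bounds:
  fixes x :: "nat \<Rightarrow> real" and n :: nat
  assumes x: "\<And>t. 0 \<le> x t" "\<And>t. x t \<le> 1"
  defines "S \<equiv> \<lambda>N. \<Sum>t=n..<N. if (\<Sum>s=n..<t. x s) < 1 then x t else 0"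
  shows "S N \<le> 2" and "1 \<le> (\<Sum>t=n..<N. x t) \<Longrightarrow> 1 \<le> S N"
proof -
  have "((\<Sum>t=n..<N. x t) < 1 \<longrightarrow> S N = (\<Sum>t=n..<N. x t)) \<and> S N \<le> 2
      \<and> (1 \<le> (\<Sum>t=n..<N. x t) \<longrightarrow> 1 \<le> S N)"
  proof (induction N)
    case 0 then show ?case by (simp add: S_def)
  next
    case (Suc N)
    show ?case
    proof (cases "n \<le> N")
      case True
      have "S (Suc N) = S N + (if (\<Sum>s=n..<N. x s) < 1 then x N else 0)"
        "(\<Sum>t=n..<Suc N. x t) = (\<Sum>t=n..<N. x t) + x N"
        using True by (simp_all add: S_def)
      then show ?thesis using Suc x[of N] by (auto split: if_splits)
    qed (simp add: S_def)
  qed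
  then show "S N \<le> 2" "1 \<le> (\<Sum>t=n..<N. x t) \<Longrightarrow> 1 \<le> S N" by auto
qed

text \<open>Each unordered pair is counted twice in the square; counting the diagonal twice as well
  only increases the right side.\<close>

lemma square_sum_le:
  fixes x :: "nat \<Rightarrow> real"
  assumes x: "\<And>t. 0 \<le> x t"
  shows "(\<Sum>t=n..<N. x t)\<^sup>2 \<le> 2 * (\<Sum>i=n..<N. \<Sum>j=i..<N. x i * x j)"
proof (induction N)
  case 0 then show ?case by simp
next
  case (Suc N)
  show ?case
  proof (cases "n \<le> N")
    case True
    have "(\<Sum>i=n..<Suc N. \<Sum>j=i..<Suc N. x i * x j) =
        (\<Sum>i=n..<N. \<Sum>j=i..<Suc N. x i * x j) + x N * x N"
      using True by simp
    also have "(\<Sum>i=n..<N. \<Sum>j=i..<Suc N. x i * x j) = (\<Sum>i=n..<N. (\<Sum>j=i..<N. x i * x j) + x i * x N)"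
      by (intro sum.cong) auto
    finally have eq: "(\<Sum>i=n..<Suc N. \<Sum>j=i..<Suc N. x i * x j) =
        (\<Sum>i=n..<N. \<Sum>j=i..<N. x i * x j) + (\<Sum>i=n..<N. x i) * x N + x N * x N"
      by (simp only: sum.distrib sum_distrib_right)
    have sq: "(\<Sum>t=n..<Suc N. x t)\<^sup>2 = (\<Sum>t=n..<N. x t)\<^sup>2 + 2 * ((\<Sum>t=n..<N. x t) * x N) + x N * x N"
      using True by (simp add: power2_eq_square algebra_simps)
    have "0 \<le> x N * x N" using x by simp
    then show ?thesis unfolding eq sq distrib_left using Suc by linarith
  qed simp
qed

context unit_supermartingale
begin

definition weighted_drop :: "nat \<Rightarrow> 'w \<Rightarrow> real" where
  "weighted_drop t \<omega> = drop_weight t (drop_at t \<omega>) * drop_at t \<omega>"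

text \<open>Stopping keeps the total of the weighted drops from time \<open>n\<close> on at most
  \<open>2\<close>, as the bound on pairs requires, and still at least \<open>1\<close> wherever
  they reach \<open>1\<close>, as the first moment requires.\<close>

definition stopped_weight :: "nat \<Rightarrow> nat \<Rightarrow> 'w \<Rightarrow> real" where
  "stopped_weight n t \<omega> =
    (if (\<Sum>s=n..<t. weighted_drop s \<omega>) < 1 then drop_weight t (drop_at t \<omega>) else 0)"

lemma weighted_drop_nonneg: "0 \<le> weighted_drop t \<omega>"
  unfolding weighted_drop_def by (intro mult_nonneg_nonneg drop_weight_nonneg drop_at_nonneg)

lemma weighted_drop_le_1: "weighted_drop t \<omega> \<le> 1"
  unfolding weighted_drop_def
  by (intro mult_le_one drop_weight_le_1 drop_at_nonneg drop_at_le_1)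

lemma drop_weight_measurable[measurable]: "drop_weight t \<in> borel_measurable borel"
  unfolding drop_weight_def[abs_def] by measurable

lemma weighted_drop_measurable: "t < j \<Longrightarrow> weighted_drop t \<in> borel_measurable (F j)"
  unfolding weighted_drop_def[abs_def] by measurable

lemma weighted_drop_measurable_M[measurable]: "weighted_drop t \<in> borel_measurable M"
  by (rule measurable_F_M[OF weighted_drop_measurable[of t "Suc t"]]) simp

lemma stopped_weight_measurable:
  assumes "t < j" shows "stopped_weight n t \<in> borel_measurable (F j)"
proof -
  have [measurable]: "(\<lambda>\<omega>. \<Sum>s=n..<t. weighted_drop s \<omega>) \<in> borel_measurable (F j)"
    using assms by (intro borel_measurable_sum weighted_drop_measurable) auto
  have [measurable]: "drop_at t \<in> borel_measurable (F j)" using assms by measurable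
  show ?thesis unfolding stopped_weight_def[abs_def] by measurable
qed

lemma stopped_weight_nonneg: "0 \<le> stopped_weight n t \<omega>"
  by (simp add: stopped_weight_def drop_weight_nonneg)

lemma stopped_weight_le: "stopped_weight n t \<omega> \<le> drop_weight t (drop_at t \<omega>)"
  by (simp add: stopped_weight_def drop_weight_nonneg)

lemma stopped_weight_le_1: "stopped_weight n t \<omega> \<le> 1"
  using stopped_weight_le drop_weight_le_1 by (rule order_trans)

lemma stopped_weight_drop_eq:
  "stopped_weight n t \<omega> * drop_at t \<omega> =
    (if (\<Sum>s=n..<t. weighted_drop s \<omega>) < 1 then weighted_drop t \<omega> else 0)"
  by (simp add: stopped_weight_def weighted_drop_def)

lemma sum_stopped_weight_le: "(\<Sum>t=n..<N. stopped_weight n t \<omega> * drop_at t \<omega>) \<le> 2"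
  unfolding stopped_weight_drop_eq
  by (rule stopped_sum_bounds(1)) (rule weighted_drop_nonneg weighted_drop_le_1)+

lemma sum_stopped_weight_ge:
  "1 \<le> (\<Sum>t=n..<N. weighted_drop t \<omega>) \<Longrightarrow> 1 \<le> (\<Sum>t=n..<N. stopped_weight n t \<omega> * drop_at t \<omega>)"
  unfolding stopped_weight_drop_eq
  by (rule stopped_sum_bounds(2)) (rule weighted_drop_nonneg weighted_drop_le_1 | assumption)+

text \<open>The price of \<open>escape j\<close> given \<open>escape i\<close>: the stopped weighted
  drop at \<open>j\<close>, divided by the lower bound \<open>1 - low (Suc j) / low i\<close> for
  the probability of \<open>escape i\<close> given \<open>F (Suc j)\<close>.\<close>

definition pair_factor :: "nat \<Rightarrow> nat \<Rightarrow> nat \<Rightarrow> 'w \<Rightarrow> real" where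
  "pair_factor n i j \<omega> = stopped_weight n j \<omega> * drop_at j \<omega> * (low i \<omega> / (low i \<omega> - low (Suc j) \<omega>))"

lemma pair_factor_nonneg: "i \<le> j \<Longrightarrow> 0 \<le> pair_factor n i j \<omega>"
  unfolding pair_factor_def using low_decseq[of i "Suc j" \<omega>]
  by (intro mult_nonneg_nonneg divide_nonneg_nonneg stopped_weight_nonneg drop_at_nonneg low_nonneg) auto

text \<open>An instance of \<open>weighted_drops_bound\<close> along each path, with the stopped
  weights as \<open>a\<close>; stopping supplies the bound \<open>2\<close> that it
  requires.\<close>

lemma sum_pair_factor_le:
  assumes "n \<le> i"
  shows "(\<Sum>j=i..<N. pair_factor n i j \<omega>) \<le> 8"
proof -
  let ?m = "running_min (\<lambda>k. Y k \<omega>)"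
  have "(\<Sum>j=i..<N. stopped_weight n j \<omega> * relative_drop ?m j) \<le>
      (\<Sum>j=n..<N. stopped_weight n j \<omega> * relative_drop ?m j)"
    using assms stopped_weight_nonneg drop_at_nonneg unfolding drop_at_def
    by (intro sum_mono2 mult_nonneg_nonneg) auto
  also have "\<dots> \<le> 2" using sum_stopped_weight_le unfolding drop_at_def .
  finally show ?thesis unfolding pair_factor_def drop_at_def low_def
    using stopped_weight_nonneg stopped_weight_le[unfolded drop_at_def] low_nonneg[unfolded low_def]
    by (intro weighted_drops_bound decseq_running_min) auto
qed

lemma pair_factor_le: "n \<le> i \<Longrightarrow> i \<le> j \<Longrightarrow> pair_factor n i j \<omega> \<le> 8"
  by (rule order_trans[OF member_le_sum[of j "{i..<Suc j}" "\<lambda>j. pair_factor n i j \<omega>"] sum_pair_factor_le])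
    (auto intro: pair_factor_nonneg)

lemma pair_factor_measurable: "i \<le> j \<Longrightarrow> pair_factor n i j \<in> borel_measurable (F (Suc j))"
  unfolding pair_factor_def[abs_def]
  by (intro borel_measurable_times borel_measurable_divide borel_measurable_diff
      stopped_weight_measurable drop_at_measurable low_measurable) auto

text \<open>The factor \<open>drop_at t / P (escape t | F (Suc t))\<close> makes the conditional expectation
  of the weighted indicator of \<open>escape t\<close> equal to \<open>drop_at t\<close>.\<close>

lemma escape_weight_exists:
  obtains w :: "'w \<Rightarrow> real" where "w \<in> borel_measurable (F (Suc t))" "\<And>\<omega>. 0 \<le> w \<omega>" "\<And>\<omega>. w \<omega> \<le> 1"
    and "same_cond_mean (F (Suc t)) (\<lambda>\<omega>. w \<omega> * indicator (escape t) \<omega>) (drop_at t)"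
proof -
  obtain p where p: "p \<in> borel_measurable (F (Suc t))" "\<And>\<omega>. 0 \<le> p \<omega>" "\<And>\<omega>. p \<omega> \<le> 1"
    and cond: "same_cond_mean (F (Suc t)) p (indicator (escape t))"
    by (rule conditional_probability_exists[OF subalg[of "Suc t"] escape_sets[of t]]) blast
  \<comment> \<open>The maximal inequality gives \<open>drop_at t <= p\<close> almost everywhere, so
    the minimum with \<open>1\<close> changes nothing there; it makes \<open>w\<close> bounded at
    every point.\<close>
  define w where "w \<omega> = (if 0 < p \<omega> then min 1 (drop_at t \<omega> / p \<omega>) else 0)" for \<omega>
  have "AE \<omega> in M. indicator (stays_below t (Suc t)) \<omega> * (low t \<omega> - Y (Suc t) \<omega>) \<le> low t \<omega> * p \<omega>"
    by (rule escape_prob_ge[OF _ p cond]) simp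
  then have ae: "AE \<omega> in M. w \<omega> * p \<omega> = drop_at t \<omega>"
  proof (rule AE_mp[OF _ AE_I2], intro impI)
    fix \<omega> assume \<omega>: "\<omega> \<in> space M"
      and le: "indicator (stays_below t (Suc t)) \<omega> * (low t \<omega> - Y (Suc t) \<omega>) \<le> low t \<omega> * p \<omega>"
    have "{t<..Suc t} = {Suc t}" by auto
    then have "low t \<omega> - low (Suc t) \<omega> = indicator (stays_below t (Suc t)) \<omega> * (low t \<omega> - Y (Suc t) \<omega>)"
      using \<omega> by (auto simp: low_Suc stays_below_def indicator_def)
    then have le': "low t \<omega> - low (Suc t) \<omega> \<le> low t \<omega> * p \<omega>" using le by simp
    have "drop_at t \<omega> \<le> p \<omega>"
    proof (cases "low t \<omega> = 0")
      case False
      then show ?thesis using le' low_nonneg[of t \<omega>] by (simp add: drop_at_eq divide_simps mult.commute)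
    qed (simp add: drop_at_eq p)
    then show "w \<omega> * p \<omega> = drop_at t \<omega>"
      using p(2)[of \<omega>] drop_at_nonneg[of t \<omega>] by (auto simp: w_def min_def divide_simps)
  qed
  have w: "w \<in> borel_measurable (F (Suc t))" unfolding w_def[abs_def] using p(1) by measurable
  have w01: "0 \<le> w \<omega>" "w \<omega> \<le> 1" for \<omega>
    using drop_at_nonneg[of t \<omega>] by (auto simp: w_def)
  show ?thesis
  proof (rule that[OF w w01])
    show "same_cond_mean (F (Suc t)) (\<lambda>\<omega>. w \<omega> * indicator (escape t) \<omega>) (drop_at t)"
      unfolding same_cond_mean_def
    proof (intro allI impI)
      fix f :: "'w \<Rightarrow> real" and C assume f: "f \<in> borel_measurable (F (Suc t))" "\<forall>\<omega>. \<bar>f \<omega>\<bar> \<le> C"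
      note [measurable] = measurable_F_M[OF f(1)] measurable_F_M[OF w] measurable_F_M[OF p(1)]
      have "\<bar>f \<omega> * w \<omega>\<bar> \<le> C" for \<omega>
        using f(2)[rule_format, of \<omega>] w01[of \<omega>] mult_mono[of "\<bar>f \<omega>\<bar>" C "w \<omega>" 1] by (simp add: abs_mult)
      then have "(\<integral>\<omega>. f \<omega> * w \<omega> * indicator (escape t) \<omega> \<partial>M) = (\<integral>\<omega>. f \<omega> * w \<omega> * p \<omega> \<partial>M)"
        using f(1) w by (intro same_cond_meanD[OF cond, symmetric]) auto
      also have "\<dots> = (\<integral>\<omega>. f \<omega> * drop_at t \<omega> \<partial>M)"
      proof (rule integral_cong_AE)
        show "AE \<omega> in M. f \<omega> * w \<omega> * p \<omega> = f \<omega> * drop_at t \<omega>"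
          using ae by eventually_elim (simp add: mult.assoc)
      qed measurable
      finally show "(\<integral>\<omega>. f \<omega> * (w \<omega> * indicator (escape t) \<omega>) \<partial>M) = (\<integral>\<omega>. f \<omega> * drop_at t \<omega> \<partial>M)"
        by (simp only: mult.assoc)
    qed
  qed
qed

text \<open>First \<open>escape i\<close> is weakened to \<open>stays_below i (Suc j)\<close>, an
  event of \<open>F (Suc j)\<close>, so that the weighted indicator of \<open>escape j\<close> may
  be exchanged for \<open>drop_at j\<close>. Then the maximal inequality bounds the indicator of
  \<open>stays_below\<close> by a multiple of the conditional probability of
  \<open>escape i\<close>, which is finally exchanged for the indicator of \<open>escape i\<close>
  itself.\<close>

lemma escape_pair_integral_le:
  assumes ni: "n \<le> i" and ij: "i \<le> j"
    and g: "g \<in> borel_measurable (F (Suc j))" "\<And>\<omega>. 0 \<le> g \<omega>" "\<And>\<omega>. g \<omega> \<le> 1"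
    and v: "v \<in> borel_measurable (F (Suc j))" "\<And>\<omega>. 0 \<le> v \<omega>" "\<And>\<omega>. v \<omega> \<le> 1"
    and cond: "same_cond_mean (F (Suc j)) (\<lambda>\<omega>. v \<omega> * indicator (escape j) \<omega>) (drop_at j)"
  shows "(\<integral>\<omega>. g \<omega> * indicator (escape i) \<omega> * (stopped_weight n j \<omega> * v \<omega> * indicator (escape j) \<omega>) \<partial>M)
    \<le> (\<integral>\<omega>. g \<omega> * indicator (escape i) \<omega> * pair_factor n i j \<omega> \<partial>M)"
proof -
  let ?R = "stays_below i (Suc j)" and ?a = "stopped_weight n j" and ?k = "pair_factor n i j"
  obtain p where p: "p \<in> borel_measurable (F (Suc j))" "\<And>\<omega>. 0 \<le> p \<omega>" "\<And>\<omega>. p \<omega> \<le> 1"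
    and condp: "same_cond_mean (F (Suc j)) p (indicator (escape i))"
    by (rule conditional_probability_exists[OF subalg[of "Suc j"] escape_sets[of i]]) blast
  have aF: "?a \<in> borel_measurable (F (Suc j))" by (rule stopped_weight_measurable) simp
  have kF: "?k \<in> borel_measurable (F (Suc j))" using ij by (rule pair_factor_measurable)
  have RF: "?R \<in> sets (F (Suc j))" using ij by (intro stays_below_sets) auto
  note [measurable] = measurable_F_M[OF g(1)] measurable_F_M[OF v(1)] measurable_F_M[OF p(1)]
    measurable_F_M[OF aF] measurable_F_M[OF kF]
  note a01 = stopped_weight_nonneg[of n j] stopped_weight_le_1[of n j]
  note k08 = pair_factor_nonneg[OF ij] pair_factor_le[OF ni ij]
  have ga: "0 \<le> g \<omega> * ?a \<omega>" "g \<omega> * ?a \<omega> \<le> 1" for \<omega>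
    using g a01 by (auto intro!: mult_nonneg_nonneg mult_le_one)
  have gav: "0 \<le> g \<omega> * ?a \<omega> * v \<omega>" "g \<omega> * ?a \<omega> * v \<omega> \<le> 1" for \<omega>
    by (rule mult_nonneg_nonneg[OF ga(1) v(2)], rule mult_le_one[OF ga(2) v(2,3)])
  have gad: "0 \<le> g \<omega> * ?a \<omega> * drop_at j \<omega>" "g \<omega> * ?a \<omega> * drop_at j \<omega> \<le> 1" for \<omega>
    by (rule mult_nonneg_nonneg[OF ga(1) drop_at_nonneg],
        rule mult_le_one[OF ga(2) drop_at_nonneg drop_at_le_1])
  have gk: "0 \<le> g \<omega> * ?k \<omega>" "g \<omega> * ?k \<omega> \<le> 8" for \<omega>
    using g k08 mult_mono[of "g \<omega>" 1 "?k \<omega>" 8] by auto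
  have gkp: "\<bar>g \<omega> * ?k \<omega> * p \<omega>\<bar> \<le> 8" for \<omega>
    using mult_nonneg_nonneg[OF gk(1) p(2), of \<omega> \<omega>] mult_mono[OF gk(2)[of \<omega>] p(3)[of \<omega>] _ p(2)]
    by (intro abs_leI) auto
  have "(\<integral>\<omega>. g \<omega> * indicator (escape i) \<omega> * (?a \<omega> * v \<omega> * indicator (escape j) \<omega>) \<partial>M)
      \<le> (\<integral>\<omega>. (g \<omega> * ?a \<omega> * indicator ?R \<omega>) * (v \<omega> * indicator (escape j) \<omega>) \<partial>M)"
  proof (rule integral_mono)
    show "integrable M (\<lambda>\<omega>. g \<omega> * indicator (escape i) \<omega> * (?a \<omega> * v \<omega> * indicator (escape j) \<omega>))"
      using gav by (intro integrable_bounded[of _ 1]) (auto simp: indicator_def mult.assoc)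
    show "integrable M (\<lambda>\<omega>. (g \<omega> * ?a \<omega> * indicator ?R \<omega>) * (v \<omega> * indicator (escape j) \<omega>))"
      using gav by (intro integrable_bounded[of _ 1]) (auto simp: indicator_def)
    fix \<omega> assume "\<omega> \<in> space M"
    show "g \<omega> * indicator (escape i) \<omega> * (?a \<omega> * v \<omega> * indicator (escape j) \<omega>)
        \<le> (g \<omega> * ?a \<omega> * indicator ?R \<omega>) * (v \<omega> * indicator (escape j) \<omega>)"
      using gav[of \<omega>] by (auto simp: escape_eq indicator_def mult.assoc)
  qed
  also have "\<dots> = (\<integral>\<omega>. (g \<omega> * ?a \<omega> * indicator ?R \<omega>) * drop_at j \<omega> \<partial>M)"
  proof (rule same_cond_meanD[OF cond, of _ 1])
    show "(\<lambda>\<omega>. g \<omega> * ?a \<omega> * indicator ?R \<omega>) \<in> borel_measurable (F (Suc j))"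
      using g(1) aF RF by (intro borel_measurable_times borel_measurable_indicator)
    show "\<bar>g \<omega> * ?a \<omega> * indicator ?R \<omega>\<bar> \<le> 1" for \<omega> using ga[of \<omega>] by (auto simp: indicator_def)
  qed
  also have "\<dots> \<le> (\<integral>\<omega>. g \<omega> * ?k \<omega> * p \<omega> \<partial>M)"
  proof (rule integral_mono_AE)
    show "integrable M (\<lambda>\<omega>. (g \<omega> * ?a \<omega> * indicator ?R \<omega>) * drop_at j \<omega>)"
      using gad by (intro integrable_bounded[of _ 1]) (auto simp: indicator_def)
    show "integrable M (\<lambda>\<omega>. g \<omega> * ?k \<omega> * p \<omega>)"
      using gkp by (intro integrable_bounded[of _ 8]) auto
    have "AE \<omega> in M. indicator ?R \<omega> * (low i \<omega> - Y (Suc j) \<omega>) \<le> low i \<omega> * p \<omega>"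
      by (rule escape_prob_ge[OF _ p condp]) (use ij in simp)
    then show "AE \<omega> in M. (g \<omega> * ?a \<omega> * indicator ?R \<omega>) * drop_at j \<omega> \<le> g \<omega> * ?k \<omega> * p \<omega>"
    proof eventually_elim
      fix \<omega> assume le: "indicator ?R \<omega> * (low i \<omega> - Y (Suc j) \<omega>) \<le> low i \<omega> * p \<omega>"
      have nn: "0 \<le> g \<omega> * ?k \<omega> * p \<omega>" using gk(1) p(2) by (rule mult_nonneg_nonneg)
      show "(g \<omega> * ?a \<omega> * indicator ?R \<omega>) * drop_at j \<omega> \<le> g \<omega> * ?k \<omega> * p \<omega>"
      proof (cases "drop_at j \<omega> = 0")
        case False
        \<comment> \<open>A nonzero drop means that \<open>Y (Suc j)\<close> is a new minimum, so
          the bound of the maximal inequality can be expressed through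
          \<open>low (Suc j)\<close>.\<close>
        then have "low (Suc j) \<omega> \<noteq> low j \<omega>" by (auto simp: drop_at_eq)
        then have lt: "low (Suc j) \<omega> < low j \<omega>" and eq: "low (Suc j) \<omega> = Y (Suc j) \<omega>"
          by (auto simp: low_Suc min_def split: if_splits)
        have pos: "0 < low i \<omega> - low (Suc j) \<omega>" using lt low_decseq[OF ij, of \<omega>] by simp
        then have "indicator ?R \<omega> \<le> low i \<omega> / (low i \<omega> - low (Suc j) \<omega>) * p \<omega>"
          using le eq by (simp add: divide_simps mult.commute)
        then have "(g \<omega> * ?a \<omega> * drop_at j \<omega>) * indicator ?R \<omega> \<le>
            (g \<omega> * ?a \<omega> * drop_at j \<omega>) * (low i \<omega> / (low i \<omega> - low (Suc j) \<omega>) * p \<omega>)"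
          using gad(1) by (rule mult_left_mono)
        then show ?thesis by (simp only: pair_factor_def ac_simps)
      qed (use nn in simp)
    qed
  qed
  also have "\<dots> = (\<integral>\<omega>. g \<omega> * ?k \<omega> * indicator (escape i) \<omega> \<partial>M)"
    using gk g(1) kF by (intro same_cond_meanD[OF condp, of _ 8]) auto
  also have "\<dots> = (\<integral>\<omega>. g \<omega> * indicator (escape i) \<omega> * ?k \<omega> \<partial>M)"
    by (simp only: ac_simps)
  finally show ?thesis .
qed

text \<open>Second moment method: \<open>\<integral>Z\<^sup>2 \<le> 16 \<integral>Z\<close>, while \<open>2 Z / 16 - (Z / 16)\<^sup>2\<close> is at most the
  indicator of \<open>Z \<noteq> 0\<close>.\<close>

lemma escape_prob_lower_bound_finite:
  assumes A: "A \<in> sets (F n)"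
  shows "prob (A \<inter> {\<omega> \<in> space M. 1 \<le> (\<Sum>t=n..<N. weighted_drop t \<omega>)})
    \<le> 16 * prob (A \<inter> (\<Union>t\<in>{n..}. escape t))"
proof -
  have AM[measurable]: "A \<in> sets M" using A by (rule sets_F_M)
  have "\<forall>t. \<exists>w. w \<in> borel_measurable (F (Suc t)) \<and> (\<forall>\<omega>. 0 \<le> w \<omega> \<and> w \<omega> \<le> 1) \<and>
      same_cond_mean (F (Suc t)) (\<lambda>\<omega>. w \<omega> * indicator (escape t) \<omega>) (drop_at t)"
    using escape_weight_exists by metis
  then obtain w where "\<forall>t. w t \<in> borel_measurable (F (Suc t)) \<and> (\<forall>\<omega>. 0 \<le> w t \<omega> \<and> w t \<omega> \<le> 1) \<and>
      same_cond_mean (F (Suc t)) (\<lambda>\<omega>. w t \<omega> * indicator (escape t) \<omega>) (drop_at t)"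
    by (rule choice[THEN exE])
  then have w: "\<And>t. w t \<in> borel_measurable (F (Suc t))" "\<And>t \<omega>. 0 \<le> w t \<omega>" "\<And>t \<omega>. w t \<omega> \<le> 1"
    and cond: "\<And>t. same_cond_mean (F (Suc t)) (\<lambda>\<omega>. w t \<omega> * indicator (escape t) \<omega>) (drop_at t)"
    by auto
  define h where "h t \<omega> = indicator A \<omega> * stopped_weight n t \<omega> * w t \<omega>" for t \<omega>
  define T where "T t \<omega> = h t \<omega> * indicator (escape t) \<omega>" for t \<omega>
  define Z where "Z \<omega> = (\<Sum>t=n..<N. T t \<omega>)" for \<omega>
  have hF: "h t \<in> borel_measurable (F (Suc j))" if "n \<le> t" "t \<le> j" for t j
    unfolding h_def[abs_def]
    using that sets_F_mono[OF A, of "Suc j"] stopped_weight_measurable[of t "Suc j" n]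
      measurable_F_mono[OF w(1)[of t], where j = "Suc j"]
    by (intro borel_measurable_times borel_measurable_indicator) auto
  have h01: "0 \<le> h t \<omega>" "h t \<omega> \<le> 1" for t \<omega>
    using stopped_weight_nonneg[of n t \<omega>] stopped_weight_le_1[of n t \<omega>] w(2,3)[of t \<omega>]
    by (auto simp: h_def indicator_def intro!: mult_le_one)
  have T01: "0 \<le> T t \<omega>" "T t \<omega> \<le> 1" for t \<omega>
    using h01[of t \<omega>] by (auto simp: T_def indicator_def)
  have swM[measurable]: "stopped_weight n t \<in> borel_measurable M" for t
    by (rule measurable_F_M[OF stopped_weight_measurable[of t "Suc t"]]) simp
  note [measurable] = measurable_F_M[OF w(1)]
  have hM[measurable]: "h t \<in> borel_measurable M" for t unfolding h_def[abs_def] by measurable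
  have TM[measurable]: "T t \<in> borel_measurable M" for t unfolding T_def[abs_def] by measurable
  have ZM[measurable]: "Z \<in> borel_measurable M" unfolding Z_def[abs_def] by measurable
  have Z0: "0 \<le> Z \<omega>" for \<omega> unfolding Z_def using T01 by (intro sum_nonneg) auto
  have "Z \<omega> \<le> real N" for \<omega>
  proof -
    have "Z \<omega> \<le> (\<Sum>t=n..<N. 1)" unfolding Z_def using T01 by (intro sum_mono) auto
    then show ?thesis by simp
  qed
  then have ZN: "\<bar>Z \<omega>\<bar> \<le> real N" for \<omega> using Z0[of \<omega>] by simp
  have intZ: "integrable M Z" using ZN by (intro integrable_bounded[of _ "real N"]) auto
  have intZ2: "integrable M (\<lambda>\<omega>. (Z \<omega>)\<^sup>2)"
    using power_mono[OF ZN abs_ge_zero, of _ 2]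
    by (intro integrable_bounded[of _ "(real N)\<^sup>2"]) auto
  have intT: "integrable M (T t)" for t using T01 by (intro integrable_bounded[of _ 1]) auto
  have intTT: "integrable M (\<lambda>\<omega>. T i \<omega> * T j \<omega>)" for i j
    using T01 by (intro integrable_bounded[of _ 1]) (auto simp: abs_mult intro!: mult_le_one)
  have kM: "pair_factor n i j \<in> borel_measurable M" if "i \<le> j" for i j
    using pair_factor_measurable[OF that] by (rule measurable_F_M)
  have intTk: "integrable M (\<lambda>\<omega>. T i \<omega> * pair_factor n i j \<omega>)" if "n \<le> i" "i \<le> j" for i j
  proof (rule integrable_bounded[of _ 8])
    show "(\<lambda>\<omega>. T i \<omega> * pair_factor n i j \<omega>) \<in> borel_measurable M"
      using kM[OF that(2)] by measurable
    show "\<bar>T i \<omega> * pair_factor n i j \<omega>\<bar> \<le> 8" for \<omega>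
      using T01[of i \<omega>] pair_factor_nonneg[OF that(2), of n \<omega>] pair_factor_le[OF that, of \<omega>]
        mult_mono[of "T i \<omega>" 1 "pair_factor n i j \<omega>" 8] by (simp add: abs_mult)
  qed
  have pair: "(\<integral>\<omega>. T i \<omega> * T j \<omega> \<partial>M) \<le> (\<integral>\<omega>. T i \<omega> * pair_factor n i j \<omega> \<partial>M)"
    if "n \<le> i" "i \<le> j" for i j
  proof -
    have "T i \<omega> * T j \<omega> = h i \<omega> * indicator (escape i) \<omega> * (stopped_weight n j \<omega> * w j \<omega> * indicator (escape j) \<omega>)" for \<omega>
      by (auto simp: T_def h_def indicator_def)
    moreover have "(\<integral>\<omega>. h i \<omega> * indicator (escape i) \<omega> * (stopped_weight n j \<omega> * w j \<omega> * indicator (escape j) \<omega>) \<partial>M)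
        \<le> (\<integral>\<omega>. h i \<omega> * indicator (escape i) \<omega> * pair_factor n i j \<omega> \<partial>M)"
      by (rule escape_pair_integral_le[OF that hF[OF that] h01 w(1)[of j] w(2,3) cond])
    ultimately show ?thesis by (simp only: T_def[of i])
  qed
  \<comment> \<open>For fixed \<open>i\<close> the pair factors add up to at most \<open>8\<close>;
    the \<open>2\<close> from \<open>square_sum_le\<close> turns this into the constant
    \<open>16\<close>.\<close>
  have "(\<integral>\<omega>. (Z \<omega>)\<^sup>2 \<partial>M) \<le> (\<integral>\<omega>. 2 * (\<Sum>i=n..<N. \<Sum>j=i..<N. T i \<omega> * T j \<omega>) \<partial>M)"
    using intZ2 intTT unfolding Z_def by (intro integral_mono square_sum_le T01) auto
  also have "\<dots> = 2 * (\<Sum>i=n..<N. \<Sum>j=i..<N. \<integral>\<omega>. T i \<omega> * T j \<omega> \<partial>M)"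
    using intTT by (simp add: Bochner_Integration.integral_sum)
  also have "\<dots> \<le> 2 * (\<Sum>i=n..<N. \<Sum>j=i..<N. \<integral>\<omega>. T i \<omega> * pair_factor n i j \<omega> \<partial>M)"
    using pair by (intro mult_left_mono sum_mono) auto
  also have "\<dots> \<le> 2 * (\<Sum>i=n..<N. \<integral>\<omega>. T i \<omega> * 8 \<partial>M)"
  proof (intro mult_left_mono sum_mono)
    fix i assume i: "i \<in> {n..<N}"
    have "(\<Sum>j=i..<N. \<integral>\<omega>. T i \<omega> * pair_factor n i j \<omega> \<partial>M) = (\<integral>\<omega>. (\<Sum>j=i..<N. T i \<omega> * pair_factor n i j \<omega>) \<partial>M)"
      using intTk i by (intro Bochner_Integration.integral_sum[symmetric]) auto
    also have "\<dots> \<le> (\<integral>\<omega>. T i \<omega> * 8 \<partial>M)"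
    proof (rule integral_mono)
      show "integrable M (\<lambda>\<omega>. \<Sum>j=i..<N. T i \<omega> * pair_factor n i j \<omega>)"
        using intTk i by (intro Bochner_Integration.integrable_sum) auto
      show "integrable M (\<lambda>\<omega>. T i \<omega> * 8)" using intT by simp
      show "(\<Sum>j=i..<N. T i \<omega> * pair_factor n i j \<omega>) \<le> T i \<omega> * 8" for \<omega>
        unfolding sum_distrib_left[symmetric]
        using i T01(1) by (intro mult_left_mono sum_pair_factor_le) auto
    qed
    finally show "(\<Sum>j=i..<N. \<integral>\<omega>. T i \<omega> * pair_factor n i j \<omega> \<partial>M) \<le> (\<integral>\<omega>. T i \<omega> * 8 \<partial>M)" .
  qed simp
  also have "\<dots> = 16 * (\<integral>\<omega>. Z \<omega> \<partial>M)"
    unfolding Z_def using intT by (simp add: Bochner_Integration.integral_sum sum_distrib_left sum_distrib_right)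
  finally have second: "(\<integral>\<omega>. (Z \<omega>)\<^sup>2 \<partial>M) \<le> 16 * (\<integral>\<omega>. Z \<omega> \<partial>M)" .
  let ?U = "A \<inter> (\<Union>t\<in>{n..}. escape t)"
  have "(\<integral>\<omega>. Z \<omega> \<partial>M) / 16 \<le> 2 * (\<integral>\<omega>. Z \<omega> \<partial>M) / 16 - (\<integral>\<omega>. (Z \<omega>)\<^sup>2 \<partial>M) / 256"
    using second by simp
  also have "\<dots> = (\<integral>\<omega>. 2 * Z \<omega> / 16 - (Z \<omega>)\<^sup>2 / 256 \<partial>M)"
    using intZ intZ2 by simp
  also have "\<dots> \<le> (\<integral>\<omega>. indicator ?U \<omega> \<partial>M)"
  proof (rule integral_mono)
    show "integrable M (\<lambda>\<omega>. 2 * Z \<omega> / 16 - (Z \<omega>)\<^sup>2 / 256)" using intZ intZ2 by simp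
    show "integrable M (indicator ?U :: 'w \<Rightarrow> real)"
      by (intro integrable_bounded[of _ 1]) (auto simp: indicator_def)
    fix \<omega>
    show "2 * Z \<omega> / 16 - (Z \<omega>)\<^sup>2 / 256 \<le> indicator ?U \<omega>"
    proof (cases "\<omega> \<in> ?U")
      case True
      have "0 \<le> (1 - Z \<omega> / 16)\<^sup>2" by simp
      then show ?thesis using True by (simp add: power2_eq_square algebra_simps)
    next
      case False
      then have "T t \<omega> = 0" if "t \<in> {n..<N}" for t
        using that by (auto simp: T_def h_def indicator_def)
      then have "Z \<omega> = 0" by (simp add: Z_def)
      then show ?thesis by simp
    qed
  qed
  also have "\<dots> = prob ?U" by simp
  finally have lower: "(\<integral>\<omega>. Z \<omega> \<partial>M) \<le> 16 * prob ?U" by simp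
  \<comment> \<open>First moment: the weight \<open>w t\<close> was chosen so that
    \<open>escape t\<close> contributes exactly the stopped weighted drop, whose sum over
    \<open>t\<close> is at least \<open>1\<close> on the event in question.\<close>
  have ET: "(\<integral>\<omega>. T t \<omega> \<partial>M) = (\<integral>\<omega>. indicator A \<omega> * (stopped_weight n t \<omega> * drop_at t \<omega>) \<partial>M)" if "n \<le> t" for t
  proof -
    have "(\<integral>\<omega>. (indicator A \<omega> * stopped_weight n t \<omega>) * (w t \<omega> * indicator (escape t) \<omega>) \<partial>M) =
        (\<integral>\<omega>. (indicator A \<omega> * stopped_weight n t \<omega>) * drop_at t \<omega> \<partial>M)"
    proof (rule same_cond_meanD[OF cond[of t], of _ 1])
      show "(\<lambda>\<omega>. indicator A \<omega> * stopped_weight n t \<omega>) \<in> borel_measurable (F (Suc t))"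
        using that sets_F_mono[OF A, of "Suc t"] stopped_weight_measurable[of t "Suc t" n]
        by (intro borel_measurable_times borel_measurable_indicator) auto
      show "\<bar>indicator A \<omega> * stopped_weight n t \<omega>\<bar> \<le> 1" for \<omega>
        using stopped_weight_nonneg[of n t \<omega>] stopped_weight_le_1[of n t \<omega>] by (auto simp: indicator_def)
    qed
    then show ?thesis by (simp add: T_def h_def mult.assoc)
  qed
  have intd: "integrable M (\<lambda>\<omega>. indicator A \<omega> * (stopped_weight n t \<omega> * drop_at t \<omega>))" for t
    using stopped_weight_nonneg stopped_weight_le_1 drop_at_nonneg drop_at_le_1
    by (intro integrable_bounded[of _ 1]) (auto simp: indicator_def abs_mult intro!: mult_le_one)
  have "prob (A \<inter> {\<omega> \<in> space M. 1 \<le> (\<Sum>t=n..<N. weighted_drop t \<omega>)}) =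
      (\<integral>\<omega>. indicator (A \<inter> {\<omega> \<in> space M. 1 \<le> (\<Sum>t=n..<N. weighted_drop t \<omega>)}) \<omega> \<partial>M)"
    by simp
  also have "\<dots> \<le> (\<integral>\<omega>. (\<Sum>t=n..<N. indicator A \<omega> * (stopped_weight n t \<omega> * drop_at t \<omega>)) \<partial>M)"
  proof (rule integral_mono)
    show "integrable M (indicator (A \<inter> {\<omega> \<in> space M. 1 \<le> (\<Sum>t=n..<N. weighted_drop t \<omega>)}) :: 'w \<Rightarrow> real)"
      by (intro integrable_bounded[of _ 1]) (auto simp: indicator_def)
    show "integrable M (\<lambda>\<omega>. \<Sum>t=n..<N. indicator A \<omega> * (stopped_weight n t \<omega> * drop_at t \<omega>))"
      using intd by (rule Bochner_Integration.integrable_sum)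
    fix \<omega>
    have "0 \<le> (\<Sum>t=n..<N. stopped_weight n t \<omega> * drop_at t \<omega>)"
      using stopped_weight_nonneg drop_at_nonneg by (intro sum_nonneg mult_nonneg_nonneg)
    then show "indicator (A \<inter> {\<omega> \<in> space M. 1 \<le> (\<Sum>t=n..<N. weighted_drop t \<omega>)}) \<omega> \<le>
        (\<Sum>t=n..<N. indicator A \<omega> * (stopped_weight n t \<omega> * drop_at t \<omega>))"
      using sum_stopped_weight_ge[of \<omega> n N] by (auto simp: indicator_def)
  qed
  also have "\<dots> = (\<integral>\<omega>. Z \<omega> \<partial>M)"
    unfolding Z_def Bochner_Integration.integral_sum[OF intd] Bochner_Integration.integral_sum[OF intT]
    using ET by (intro sum.cong) auto
  finally show ?thesis using lower by simp
qed

end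

section \<open>Approximation by events of the past and infinitely many escapes\<close>

context unit_supermartingale
begin

lemma sigma_filtration_sets_M: "B \<in> sigma_sets (space M) (\<Union>n. sets (F n)) \<Longrightarrow> B \<in> sets M"
  using sets.sigma_sets_subset[of "\<Union>n. sets (F n)" M] sets_F_M by blast

text \<open>The events that can be approximated in probability are closed under complements, which
  leave the symmetric difference unchanged, and under countable unions, which are first truncated to
  finite ones.\<close>

lemma approximation_by_filtration:
  assumes "B \<in> sigma_sets (space M) (\<Union>n. sets (F n))" and "0 < \<epsilon>"
  shows "\<exists>n A. A \<in> sets (F n) \<and> prob (A - B \<union> (B - A)) < \<epsilon>"
  using assms
proof (induction arbitrary: \<epsilon> rule: sigma_sets.induct)
  case (Basic B)
  then obtain n where "B \<in> sets (F n)" by auto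
  then show ?case using Basic.prems by (intro exI[of _ n] exI[of _ B]) simp
next
  case Empty
  then show ?case by (intro exI[of _ 0] exI[of _ "{}"]) simp
next
  case (Compl B)
  then obtain n A where A: "A \<in> sets (F n)" "prob (A - B \<union> (B - A)) < \<epsilon>" by blast
  have "A \<subseteq> space M" "B \<subseteq> space M"
    using sets_F_M[OF A(1)] sigma_filtration_sets_M[OF Compl.hyps] sets.sets_into_space by auto
  then have "(space M - A) - (space M - B) \<union> ((space M - B) - (space M - A)) = A - B \<union> (B - A)"
    by blast
  moreover have "space M - A \<in> sets (F n)"
    using A(1) sets.compl_sets[of A "F n"] by (simp add: space_F)
  ultimately show ?case using A(2) by (intro exI[of _ n] exI[of _ "space M - A"]) simp
next
  case (Union f)
  have f[measurable]: "f i \<in> sets M" for i using Union.hyps by (rule sigma_filtration_sets_M)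
  \<comment> \<open>For finitely many sets the approximations all lie in one \<open>F n\<close>,
    because the filtration is increasing.\<close>
  have fin: "\<exists>n A. A \<in> sets (F n) \<and> prob (A - (\<Union>i<k. f i) \<union> ((\<Union>i<k. f i) - A)) < \<delta>" if "0 < \<delta>" for k \<delta>
    using that
  proof (induction k arbitrary: \<delta>)
    case 0
    then show ?case by (intro exI[of _ 0] exI[of _ "{}"]) simp
  next
    case (Suc k)
    obtain n1 A1 where A1: "A1 \<in> sets (F n1)" "prob (A1 - (\<Union>i<k. f i) \<union> ((\<Union>i<k. f i) - A1)) < \<delta> / 2"
      using Suc.IH[of "\<delta> / 2"] Suc.prems by auto
    obtain n2 A2 where A2: "A2 \<in> sets (F n2)" "prob (A2 - f k \<union> (f k - A2)) < \<delta> / 2"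
      using Union.IH[of "\<delta> / 2" k] Suc.prems by auto
    note [measurable] = sets_F_M[OF A1(1)] sets_F_M[OF A2(1)]
    let ?S1 = "A1 - (\<Union>i<k. f i) \<union> ((\<Union>i<k. f i) - A1)" and ?S2 = "A2 - f k \<union> (f k - A2)"
    have "prob (A1 \<union> A2 - (\<Union>i<Suc k. f i) \<union> ((\<Union>i<Suc k. f i) - (A1 \<union> A2))) \<le> prob (?S1 \<union> ?S2)"
      by (intro finite_measure_mono) (auto simp: lessThan_Suc)
    also have "\<dots> \<le> prob ?S1 + prob ?S2" by (intro measure_Un_le) auto
    also have "\<dots> < \<delta>" using A1(2) A2(2) by simp
    finally show ?case
      using sets_F_mono[OF A1(1), of "max n1 n2"] sets_F_mono[OF A2(1), of "max n1 n2"]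
      by (intro exI[of _ "max n1 n2"] exI[of _ "A1 \<union> A2"]) auto
  qed
  have "(\<lambda>k. prob (\<Union>i<k. f i)) \<longlonglongrightarrow> prob (\<Union>k. \<Union>i<k. f i)"
    by (rule finite_Lim_measure_incseq) (auto intro!: incseq_SucI simp: lessThan_Suc)
  moreover have eq: "(\<Union>k. \<Union>i<k. f i) = (\<Union>i. f i)" by auto
  ultimately have "(\<lambda>k. prob (\<Union>i<k. f i)) \<longlonglongrightarrow> prob (\<Union>i. f i)" by simp
  then have "eventually (\<lambda>k. prob (\<Union>i. f i) - \<epsilon> / 2 < prob (\<Union>i<k. f i)) sequentially"
    using Union.prems by (intro order_tendstoD) auto
  then obtain k where k: "prob (\<Union>i. f i) - \<epsilon> / 2 < prob (\<Union>i<k. f i)"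
    by (auto simp: eventually_sequentially)
  have diff: "prob ((\<Union>i. f i) - (\<Union>i<k. f i)) < \<epsilon> / 2"
    using k by (subst finite_measure_Diff) auto
  obtain n A where A: "A \<in> sets (F n)" "prob (A - (\<Union>i<k. f i) \<union> ((\<Union>i<k. f i) - A)) < \<epsilon> / 2"
    using fin[of "\<epsilon> / 2" k] Union.prems by auto
  note [measurable] = sets_F_M[OF A(1)]
  let ?S = "A - (\<Union>i<k. f i) \<union> ((\<Union>i<k. f i) - A)"
  have "prob (A - (\<Union>i. f i) \<union> ((\<Union>i. f i) - A)) \<le> prob (?S \<union> ((\<Union>i. f i) - (\<Union>i<k. f i)))"
    by (intro finite_measure_mono) auto
  also have "\<dots> \<le> prob ?S + prob ((\<Union>i. f i) - (\<Union>i<k. f i))"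
    by (intro measure_Un_le) auto
  also have "\<dots> < \<epsilon>" using A(2) diff by simp
  finally show ?case using A(1) by blast
qed

text \<open>Divergence is expressed by natural bounds \<open>K\<close>, so that only countable
  quantifiers occur and measurability is immediate.\<close>

definition infinite_drops :: "'w set" where
  "infinite_drops = {\<omega> \<in> space M. \<forall>K::nat. \<exists>N. real K \<le> (\<Sum>t<N. weighted_drop t \<omega>)}"

lemma infinite_drops_sets[measurable]: "infinite_drops \<in> sets M"
  unfolding infinite_drops_def by measurable

lemma escape_prob_lower_bound:
  assumes A: "A \<in> sets (F n)"
  shows "prob (A \<inter> infinite_drops) \<le> 16 * prob (A \<inter> (\<Union>t\<in>{n..}. escape t))"
proof -
  note [measurable] = sets_F_M[OF A]
  define S where "S N = A \<inter> {\<omega> \<in> space M. 1 \<le> (\<Sum>t=n..<N. weighted_drop t \<omega>)}" for N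
  have [measurable]: "S N \<in> sets M" for N unfolding S_def by measurable
  have "incseq S"
  proof (rule incseq_SucI, rule subsetI)
    fix N \<omega> assume "\<omega> \<in> S N"
    then show "\<omega> \<in> S (Suc N)" using weighted_drop_nonneg[of N \<omega>] by (cases "n \<le> N") (auto simp: S_def)
  qed
  then have lim: "(\<lambda>N. prob (S N)) \<longlonglongrightarrow> prob (\<Union>N. S N)"
    by (intro finite_Lim_measure_incseq) auto
  have "A \<inter> infinite_drops \<subseteq> (\<Union>N. S N)"
  proof
    fix \<omega> assume \<omega>: "\<omega> \<in> A \<inter> infinite_drops"
    \<comment> \<open>Each of the first \<open>n\<close> weighted drops is at most \<open>1\<close>,
      so a partial sum of at least \<open>n + 1\<close> leaves at least \<open>1\<close> for the
      times from \<open>n\<close> on.\<close>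
    then obtain N where N: "real (Suc n) \<le> (\<Sum>t<N. weighted_drop t \<omega>)"
      unfolding infinite_drops_def by blast
    have "(\<Sum>t<N. weighted_drop t \<omega>) \<le> (\<Sum>t\<in>{..<n} \<union> {n..<N}. weighted_drop t \<omega>)"
      using weighted_drop_nonneg by (intro sum_mono2) auto
    also have "\<dots> = (\<Sum>t<n. weighted_drop t \<omega>) + (\<Sum>t=n..<N. weighted_drop t \<omega>)"
      by (rule sum.union_disjoint) auto
    also have "(\<Sum>t<n. weighted_drop t \<omega>) \<le> (\<Sum>t<n. 1)"
      using weighted_drop_le_1 by (intro sum_mono) auto
    finally have "1 \<le> (\<Sum>t=n..<N. weighted_drop t \<omega>)" using N by simp
    then show "\<omega> \<in> (\<Union>N. S N)" using \<omega> by (auto simp: S_def infinite_drops_def)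
  qed
  then have "prob (A \<inter> infinite_drops) \<le> prob (\<Union>N. S N)" by (intro finite_measure_mono) auto
  also have "\<dots> \<le> 16 * prob (A \<inter> (\<Union>t\<in>{n..}. escape t))"
    using lim by (rule LIMSEQ_le_const2) (auto simp: S_def intro: escape_prob_lower_bound_finite[OF A])
  finally show ?thesis .
qed

text \<open>Makes the exceptional event accessible to the approximation: it is determined by the
  processes adapted to the filtration.\<close>

lemma infinite_drops_without_escape_sigma:
  "infinite_drops - (\<Union>t\<in>{m..}. escape t) \<in> sigma_sets (space M) (\<Union>n. sets (F n))"
proof -
  define G where "G = sigma (space M) (\<Union>n. sets (F n))"
  have "sets (F n) \<subseteq> Pow (space M)" for n using sets.space_closed[of "F n"] by (simp add: space_F)
  then have sub: "(\<Union>n. sets (F n)) \<subseteq> Pow (space M)" by auto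
  have sG: "sets G = sigma_sets (space M) (\<Union>n. sets (F n))" "space G = space M"
    unfolding G_def using sub by (simp_all add: sets_measure_of space_measure_of)
  have GF: "subalgebra G (F n)" for n
    unfolding subalgebra_def sG space_F by auto
  have [measurable]: "Y i \<in> borel_measurable G" "low i \<in> borel_measurable G"
      "weighted_drop i \<in> borel_measurable G" for i
    using measurable_from_subalg[OF GF Y_measurable[of i i]]
      measurable_from_subalg[OF GF low_measurable[of i i]]
      measurable_from_subalg[OF GF weighted_drop_measurable[of i "Suc i"]] by auto
  have "escape t \<in> sets G" for t unfolding escape_def sG(2)[symmetric] by measurable
  moreover have "infinite_drops \<in> sets G" unfolding infinite_drops_def sG(2)[symmetric] by measurable
  ultimately have "infinite_drops - (\<Union>t\<in>{m..}. escape t) \<in> sets G" by auto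
  then show ?thesis by (simp add: sG)
qed

text \<open>Let \<open>B\<close> be the event of infinite drops with no escape from time
  \<open>m\<close> on, and let \<open>A\<close> from the past approximate \<open>B\<close> up to
  \<epsilon>. The lower bound applied to \<open>A\<close> forces an escape with probability
  comparable to that of \<open>B\<close>, but such an escape can occur only on \<open>A - B\<close>.
  Hence \<open>B\<close> has probability at most \<open>17 * \<epsilon>\<close>.\<close>

theorem escape_infinitely_often:
  "AE \<omega> in M. (\<forall>K::nat. \<exists>N. real K \<le> (\<Sum>t<N. weighted_drop t \<omega>)) \<longrightarrow> (\<forall>m. \<exists>t\<ge>m. \<omega> \<in> escape t)"
proof -
  define U where "U m = (\<Union>t\<in>{m..}. escape t)" for m
  have [measurable]: "U m \<in> sets M" for m unfolding U_def by auto
  have le: "prob (infinite_drops - U m) \<le> 17 * \<epsilon>" if pos: "0 < \<epsilon>" for m \<epsilon>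
  proof -
    let ?B = "infinite_drops - U m"
    obtain k A where A: "A \<in> sets (F k)" "prob (A - ?B \<union> (?B - A)) < \<epsilon>"
      using approximation_by_filtration[OF infinite_drops_without_escape_sigma[of m] pos]
      unfolding U_def by blast
    note [measurable] = sets_F_M[OF A(1)]
    define n where "n = max k m"
    have "prob ?B \<le> prob ((A \<inter> infinite_drops) \<union> (A - ?B \<union> (?B - A)))"
      by (intro finite_measure_mono) auto
    also have "\<dots> \<le> prob (A \<inter> infinite_drops) + prob (A - ?B \<union> (?B - A))"
      by (intro measure_Un_le) auto
    also have "prob (A \<inter> infinite_drops) \<le> 16 * prob (A \<inter> U n)"
      unfolding U_def by (intro escape_prob_lower_bound sets_F_mono[OF A(1)]) (simp add: n_def)
    \<comment> \<open>Here \<open>m <= n\<close> matters: an escape at or after \<open>n\<close> is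
      one at or after \<open>m\<close>, so it excludes \<open>B\<close>.\<close>
    also have "prob (A \<inter> U n) \<le> prob (A - ?B \<union> (?B - A))"
      by (intro finite_measure_mono) (auto simp: U_def n_def)
    finally show ?thesis using A(2) by simp
  qed
  have "prob (infinite_drops - U m) = 0" for m
  proof (rule ccontr)
    assume "prob (infinite_drops - U m) \<noteq> 0"
    then have "0 < prob (infinite_drops - U m)" by (simp add: zero_less_measure_iff)
    then show False using le[of "prob (infinite_drops - U m) / 18" m] by simp
  qed
  then have "AE \<omega> in M. \<omega> \<notin> infinite_drops - U m" for m
    by (intro AE_not_in) (auto simp: null_sets_def emeasure_eq_measure)
  then have "AE \<omega> in M. \<forall>m. \<omega> \<notin> infinite_drops - U m"
    by (subst AE_all_countable) blast
  then show ?thesis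
    by (rule AE_mp[OF _ AE_I2]) (auto simp: infinite_drops_def U_def)
qed

end

section \<open>Hitting probabilities\<close>

lemma hit_within_bounds: "0 \<le> hit_within P n x y \<and> hit_within P n x y \<le> 1"
proof (induction n arbitrary: x)
  case (Suc n)
  have "measure_pmf.expectation (P x) (\<lambda>z. hit_within P n z y) \<le> measure_pmf.expectation (P x) (\<lambda>_. 1)"
    using Suc by (intro integral_mono measure_pmf.integrable_bounded[of _ _ 1]) auto
  moreover have "0 \<le> measure_pmf.expectation (P x) (\<lambda>z. hit_within P n z y)"
    using Suc by (intro integral_nonneg_AE) auto
  ultimately show ?case by simp
qed simp

lemma abs_hit_within_le_1: "\<bar>hit_within P n x y\<bar> \<le> 1"
  using hit_within_bounds[of P n x y] by simp

lemma integrable_hit_within: "integrable (measure_pmf p) (\<lambda>z. hit_within P n z y)"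
  using abs_hit_within_le_1 by (intro measure_pmf.integrable_bounded[of _ _ 1]) auto

lemma incseq_hit_within: "incseq (\<lambda>n. hit_within P n x y)"
proof (rule incseq_SucI)
  show "hit_within P n x y \<le> hit_within P (Suc n) x y" for n
  proof (induction n arbitrary: x)
    case 0
    then show ?case using hit_within_bounds[of P "Suc 0" x y] by (auto simp del: hit_within.simps(2) simp: hit_within.simps(2)[of P 0 y y])
  next
    case (Suc n)
    then have "measure_pmf.expectation (P x) (\<lambda>z. hit_within P n z y) \<le>
        measure_pmf.expectation (P x) (\<lambda>z. hit_within P (Suc n) z y)"
      by (intro integral_mono integrable_hit_within) auto
    then show ?case by (simp del: hit_within.simps add: hit_within.simps(2)[of P n] hit_within.simps(2)[of P "Suc n"])
  qed
qed

lemma hit_within_le_hit_prob: "hit_within P n x y \<le> hit_prob P x y"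
  unfolding hit_prob_def using hit_within_bounds
  by (intro cSUP_upper bdd_aboveI2[of _ _ 1]) auto

lemma LIMSEQ_hit_within: "(\<lambda>n. hit_within P n x y) \<longlonglongrightarrow> hit_prob P x y"
  unfolding hit_prob_def using hit_within_bounds incseq_hit_within
  by (intro LIMSEQ_incseq_SUP bdd_aboveI2[of _ _ 1]) auto

lemma hit_prob_nonneg: "0 \<le> hit_prob P x y"
  using hit_within_bounds hit_within_le_hit_prob order_trans by blast

lemma hit_prob_le_1: "hit_prob P x y \<le> 1"
  unfolding hit_prob_def using hit_within_bounds by (intro cSUP_least) auto

lemma abs_hit_prob_le_1: "\<bar>hit_prob P x y\<bar> \<le> 1"
  using hit_prob_nonneg[of P x y] hit_prob_le_1[of P x y] by simp

text \<open>Away from \<open>y\<close> this is the one-step recursion of \<open>hit_within\<close>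
  in the limit; at \<open>y\<close> the right side is \<open>1\<close>. The nonnegative integral is
  used because the path laws are integrated in that form.\<close>

lemma hit_prob_superharmonic:
  "(\<integral>\<^sup>+z. ennreal (hit_prob P z y) \<partial>measure_pmf (P x)) \<le> ennreal (hit_prob P x y)"
proof -
  have int: "integrable (measure_pmf (P x)) (\<lambda>z. hit_prob P z y)"
    using abs_hit_prob_le_1 by (intro measure_pmf.integrable_bounded[of _ _ 1]) auto
  have "measure_pmf.expectation (P x) (\<lambda>z. hit_prob P z y) \<le> hit_prob P x y"
  proof (cases "x = y")
    case True
    have "measure_pmf.expectation (P x) (\<lambda>z. hit_prob P z y) \<le> measure_pmf.expectation (P x) (\<lambda>_. 1)"
      using int hit_prob_le_1 by (intro integral_mono) auto
    also have "\<dots> \<le> hit_prob P x y" using hit_within_le_hit_prob[of P 0 x y] True by simp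
    finally show ?thesis .
  next
    case False
    have "(\<lambda>n. measure_pmf.expectation (P x) (\<lambda>z. hit_within P n z y)) \<longlonglongrightarrow>
        measure_pmf.expectation (P x) (\<lambda>z. hit_prob P z y)"
      using abs_hit_within_le_1
      by (intro integral_dominated_convergence[where w = "\<lambda>_. 1"] AE_I2 LIMSEQ_hit_within) auto
    moreover have "measure_pmf.expectation (P x) (\<lambda>z. hit_within P n z y) \<le> hit_prob P x y" for n
      using hit_within_le_hit_prob[of P "Suc n" x y] False by simp
    ultimately show ?thesis by (intro LIMSEQ_le_const2) auto
  qed
  then show ?thesis using int hit_prob_nonneg
    by (subst nn_integral_eq_integral) (auto intro!: ennreal_leI)
qed

text \<open>Powers are defined by appending a last step, whereas \<open>hit_within\<close> recurses
  on the first step; this reconciles the two.\<close>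

lemma kernel_pow_Suc_left: "kernel_pow P (Suc n) u = bind_pmf (P u) (kernel_pow P n)"
proof (induction n)
  case 0
  show ?case by (simp add: bind_return_pmf bind_return_pmf')
next
  case (Suc n)
  have "kernel_pow P (Suc (Suc n)) u = bind_pmf (kernel_pow P (Suc n) u) P" by simp
  also have "\<dots> = bind_pmf (P u) (\<lambda>z. bind_pmf (kernel_pow P n z) P)"
    unfolding Suc by (rule bind_assoc_pmf)
  finally show ?case by simp
qed

lemma pmf_kernel_pow_le_hit_within: "pmf (kernel_pow P n x) y \<le> hit_within P n x y"
proof (induction n arbitrary: x)
  case 0
  show ?case by (simp add: pmf_return)
next
  case (Suc n)
  show ?case
  proof (cases "x = y")
    case True
    then show ?thesis using pmf_le_1 by simp
  next
    case False
    have "pmf (kernel_pow P (Suc n) x) y = measure_pmf.expectation (P x) (\<lambda>z. pmf (kernel_pow P n z) y)"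
      unfolding kernel_pow_Suc_left by (rule pmf_bind)
    also have "\<dots> \<le> measure_pmf.expectation (P x) (\<lambda>z. hit_within P n z y)"
      using Suc pmf_nonneg pmf_le_1
      by (intro integral_mono integrable_hit_within measure_pmf.integrable_bounded[of _ _ 1]) auto
    finally show ?thesis using False by simp
  qed
qed

text \<open>Supplies the positivity that the logarithms require along a path that is never
  killed.\<close>

lemma hit_prob_pos:
  assumes "irreducible_chain P dag" "x \<noteq> dag" "y \<noteq> dag"
  shows "0 < hit_prob P x y"
proof -
  obtain n where "0 < pmf (kernel_pow P n x) y"
    using assms unfolding irreducible_chain_def by blast
  also have "\<dots> \<le> hit_within P n x y" by (rule pmf_kernel_pow_le_hit_within)
  also have "\<dots> \<le> hit_prob P x y" by (rule hit_within_le_hit_prob)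
  finally show ?thesis .
qed

section \<open>Laws of path prefixes and the supermartingale of hitting probabilities\<close>

text \<open>Turns the law of a path prefix into a \<open>pmf\<close>, so that a further step of the
  chain can be written with \<open>bind_pmf\<close>.\<close>

lemma pmf_of_countable_prob_space:
  fixes N :: "'a::countable measure"
  assumes "prob_space N" and sets: "sets N = UNIV"
  obtains p where "measure_pmf p = N"
proof -
  interpret prob_space N by fact
  have "AE x in N. x \<noteq> a" if "measure N {a} = 0" for a
    using that AE_not_in[of "{a}" N] by (auto simp: null_sets_def emeasure_eq_measure sets)
  then have "AE x in N. \<forall>a\<in>{a. measure N {a} = 0}. x \<noteq> a"
    by (subst AE_ball_countable) auto
  then have "AE x in N. measure N {x} \<noteq> 0" by eventually_elim auto
  then have "measure_pmf (Abs_pmf N) = N"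
    using assms by (intro Abs_pmf_inverse) auto
  then show ?thesis by (rule that)
qed

lemma pmf_bind_snoc:
  "pmf (bind_pmf p (\<lambda>l. map_pmf (\<lambda>z. l @ [z]) (Q l))) (l @ [z]) = pmf p l * pmf (Q l) z"
proof -
  have "pmf (map_pmf (\<lambda>z. l' @ [z]) (Q l')) (l @ [z]) = indicator {l} l' * pmf (Q l) z" for l'
  proof (cases "l' = l")
    case True
    have "inj (\<lambda>z. l @ [z])" by (auto intro: injI)
    then have "pmf (map_pmf (\<lambda>z. l @ [z]) (Q l)) (l @ [z]) = pmf (Q l) z" by (rule pmf_map_inj')
    then show ?thesis using True by simp
  next
    case False
    then show ?thesis by (auto simp: pmf_eq_0_set_pmf)
  qed
  then have "pmf (bind_pmf p (\<lambda>l. map_pmf (\<lambda>z. l @ [z]) (Q l))) (l @ [z]) =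
      (\<integral>l'. indicator {l} l' * pmf (Q l) z \<partial>measure_pmf p)"
    by (simp only: pmf_bind)
  then show ?thesis by (simp add: pmf.rep_eq)
qed

definition path_prefix :: "(nat \<Rightarrow> 'w \<Rightarrow> 'a) \<Rightarrow> nat \<Rightarrow> 'w \<Rightarrow> 'a list" where
  "path_prefix X n \<omega> = map (\<lambda>i. X i \<omega>) [0..<Suc n]"

lemma path_prefix_Suc: "path_prefix X (Suc n) \<omega> = path_prefix X n \<omega> @ [X (Suc n) \<omega>]"
  by (simp add: path_prefix_def)

lemma hd_path_prefix: "hd (path_prefix X n \<omega>) = X 0 \<omega>"
  by (induction n) (simp_all add: path_prefix_def hd_append upt_conv_Cons del: upt_Suc)

lemma last_path_prefix: "last (path_prefix X n \<omega>) = X n \<omega>"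
  by (simp add: path_prefix_def)

lemma length_path_prefix: "length (path_prefix X n \<omega>) = Suc n"
  by (simp add: path_prefix_def)

lemma path_prefix_eq_iff:
  "path_prefix X n \<omega> = l \<longleftrightarrow> length l = Suc n \<and> (\<forall>i\<le>n. X i \<omega> = l ! i)"
  by (auto simp: path_prefix_def list_eq_iff_nth_eq less_Suc_eq_le simp del: upt_Suc)

context
  fixes M :: "'w measure" and P :: "'a::countable \<Rightarrow> 'a pmf" and X :: "nat \<Rightarrow> 'w \<Rightarrow> 'a"
  assumes traj: "trajectory M P X"
begin

interpretation prob_space M
  using traj by (simp add: trajectory_def)

lemma path_prefix_measurable: "path_prefix X n \<in> measurable M (count_space UNIV)"
proof -
  have X[measurable]: "X i \<in> measurable M (count_space UNIV)" for i
    using traj by (simp add: trajectory_def)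
  have "path_prefix X n -` {l} \<inter> space M \<in> sets M" for l
  proof -
    have "path_prefix X n -` {l} \<inter> space M =
        {\<omega> \<in> space M. length l = Suc n \<and> (\<forall>i\<in>{..n}. X i \<omega> = l ! i)}"
      unfolding vimage_def singleton_iff path_prefix_eq_iff by blast
    also have "\<dots> \<in> sets M" by measurable
    finally show ?thesis .
  qed
  then show ?thesis by (simp add: measurable_count_space_eq2_countable)
qed

text \<open>The Markov property in one-step form: the product formula for trajectories gains one
  factor. Lists of the wrong length have probability \<open>0\<close> on both sides.\<close>

lemma measure_path_prefix_snoc:
  "measure M (path_prefix X (Suc n) -` {l @ [z]} \<inter> space M)
    = measure M (path_prefix X n -` {l} \<inter> space M) * pmf (P (last l)) z"
proof (cases "length l = Suc n")
  case True
  have eq: "path_prefix X k -` {l'} \<inter> space M = {\<omega> \<in> space M. \<forall>i\<le>k. X i \<omega> = l' ! i}"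
    if "length l' = Suc k" for k l'
    unfolding vimage_def singleton_iff path_prefix_eq_iff using that by blast
  have law: "measure M {\<omega> \<in> space M. \<forall>i\<le>k. X i \<omega> = l' ! i} =
      measure M {\<omega> \<in> space M. X 0 \<omega> = l' ! 0} * (\<Prod>i<k. pmf (P (l' ! i)) (l' ! Suc i))"
    if "length l' = Suc k" for k l'
    using traj that by (simp add: trajectory_def)
  have "(\<Prod>i<Suc n. pmf (P ((l @ [z]) ! i)) ((l @ [z]) ! Suc i)) =
      (\<Prod>i<n. pmf (P (l ! i)) (l ! Suc i)) * pmf (P (last l)) z"
  proof -
    have "l \<noteq> []" using True by auto
    then have "(l @ [z]) ! n = last l" "(l @ [z]) ! Suc n = z"
      using True by (simp_all add: nth_append last_conv_nth)
    moreover have "(\<Prod>i<n. pmf (P ((l @ [z]) ! i)) ((l @ [z]) ! Suc i)) = (\<Prod>i<n. pmf (P (l ! i)) (l ! Suc i))"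
      using True by (intro prod.cong) (simp_all add: nth_append)
    ultimately show ?thesis by simp
  qed
  moreover have "(l @ [z]) ! 0 = l ! 0" using True by (simp add: nth_append)
  ultimately show ?thesis
    using True by (simp add: eq law)
next
  case False
  then have "path_prefix X (Suc n) -` {l @ [z]} = {}" "path_prefix X n -` {l} = {}"
    by (auto simp: path_prefix_Suc length_path_prefix)
  then show ?thesis by simp
qed

lemma path_prefix_law_exists:
  obtains p where "measure_pmf p = distr M (count_space UNIV) (path_prefix X n)"
  by (rule pmf_of_countable_prob_space[OF prob_space_distr[OF path_prefix_measurable[of n]]]) auto

lemma path_prefix_law_Suc:
  assumes p: "measure_pmf p = distr M (count_space UNIV) (path_prefix X n)"
  shows "measure_pmf (bind_pmf p (\<lambda>l. map_pmf (\<lambda>z. l @ [z]) (P (last l))))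
    = distr M (count_space UNIV) (path_prefix X (Suc n))"
proof -
  obtain p' where p': "measure_pmf p' = distr M (count_space UNIV) (path_prefix X (Suc n))"
    by (rule path_prefix_law_exists)
  have "bind_pmf p (\<lambda>l. map_pmf (\<lambda>z. l @ [z]) (P (last l))) = p'"
  proof (rule pmf_eqI)
    fix l'
    have m: "pmf p' l = measure M (path_prefix X (Suc n) -` {l} \<inter> space M)"
      "pmf p l = measure M (path_prefix X n -` {l} \<inter> space M)" for l
      by (simp_all add: pmf.rep_eq p p' measure_distr[OF path_prefix_measurable])
    show "pmf (bind_pmf p (\<lambda>l. map_pmf (\<lambda>z. l @ [z]) (P (last l)))) l' = pmf p' l'"
    proof (cases l' rule: rev_cases)
      case Nil
      have "path_prefix X (Suc n) -` {[]} = {}" by (auto simp: path_prefix_eq_iff)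
      then have "pmf p' [] = 0" by (simp add: m)
      moreover have "pmf (bind_pmf p (\<lambda>l. map_pmf (\<lambda>z. l @ [z]) (P (last l)))) [] = 0"
        unfolding pmf_eq_0_set_pmf by auto
      ultimately show ?thesis using Nil by simp
    next
      case (snoc l z)
      then show ?thesis by (simp add: pmf_bind_snoc m measure_path_prefix_snoc)
    qed
  qed
  then show ?thesis using p' by simp
qed

text \<open>The natural filtration of \<open>X\<close>. As it is generated by one variable with
  values in a countable type, its events are exactly the preimages of sets of lists.\<close>

definition path_algebra :: "nat \<Rightarrow> 'w measure" where
  "path_algebra n = vimage_algebra (space M) (path_prefix X n) (count_space UNIV)"

lemma sets_path_algebra: "sets (path_algebra n) = range (\<lambda>S. path_prefix X n -` S \<inter> space M)"
  unfolding path_algebra_def by (subst sets_vimage_algebra2) auto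

lemma space_path_algebra: "space (path_algebra n) = space M"
  by (simp add: path_algebra_def)

text \<open>The target \<open>X 0\<close> is random but is the head of the prefix. It is therefore
  fixed while the next step is averaged, and superharmonicity applies to each prefix
  separately.\<close>

lemma hit_prob_supermartingale:
  assumes B: "B \<in> sets (path_algebra n)"
  shows "(\<integral>\<omega>. indicator B \<omega> * hit_prob P (X (Suc n) \<omega>) (X 0 \<omega>) \<partial>M)
    \<le> (\<integral>\<omega>. indicator B \<omega> * hit_prob P (X n \<omega>) (X 0 \<omega>) \<partial>M)"
proof -
  obtain S where S: "B = path_prefix X n -` S \<inter> space M" using B by (auto simp: sets_path_algebra)
  have [measurable]: "path_prefix X n \<in> measurable M (count_space UNIV)" for n
    by (rule path_prefix_measurable)
  have BM[measurable]: "B \<in> sets M" unfolding S by measurable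
  have hM[measurable]: "(\<lambda>\<omega>. hit_prob P (X n \<omega>) (X 0 \<omega>)) \<in> borel_measurable M" for n
  proof -
    have "(\<lambda>\<omega>. hit_prob P (last (path_prefix X n \<omega>)) (hd (path_prefix X n \<omega>))) \<in> borel_measurable M"
      by measurable
    then show ?thesis by (simp add: last_path_prefix hd_path_prefix)
  qed
  obtain p where p: "measure_pmf p = distr M (count_space UNIV) (path_prefix X n)"
    by (rule path_prefix_law_exists)
  let ?p' = "bind_pmf p (\<lambda>l. map_pmf (\<lambda>z. l @ [z]) (P (last l)))"
  \<comment> \<open>The first argument is the prefix up to time \<open>n\<close>, which decides
    membership in \<open>B\<close> and the target; the second supplies the current state.\<close>
  let ?g = "\<lambda>l l'. indicator S l * ennreal (hit_prob P (last l') (hd l))"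
  have "(\<integral>\<^sup>+\<omega>. ennreal (indicator B \<omega> * hit_prob P (X (Suc n) \<omega>) (X 0 \<omega>)) \<partial>M) =
      (\<integral>\<^sup>+\<omega>. ?g (butlast (path_prefix X (Suc n) \<omega>)) (path_prefix X (Suc n) \<omega>) \<partial>M)"
    by (intro nn_integral_cong)
      (auto simp: S path_prefix_Suc hd_path_prefix indicator_def)
  also have "\<dots> = (\<integral>\<^sup>+l'. ?g (butlast l') l' \<partial>distr M (count_space UNIV) (path_prefix X (Suc n)))"
    by (subst nn_integral_distr) auto
  also have "\<dots> = (\<integral>\<^sup>+l. indicator S l * (\<integral>\<^sup>+z. ennreal (hit_prob P z (hd l)) \<partial>measure_pmf (P (last l))) \<partial>measure_pmf p)"
    unfolding path_prefix_law_Suc[OF p, symmetric] by (simp add: nn_integral_cmult)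
  also have "\<dots> \<le> (\<integral>\<^sup>+l. ?g l l \<partial>measure_pmf p)"
    by (intro nn_integral_mono mult_left_mono hit_prob_superharmonic) auto
  also have "\<dots> = (\<integral>\<^sup>+\<omega>. ?g (path_prefix X n \<omega>) (path_prefix X n \<omega>) \<partial>M)"
    unfolding p by (subst nn_integral_distr) auto
  also have "\<dots> = (\<integral>\<^sup>+\<omega>. ennreal (indicator B \<omega> * hit_prob P (X n \<omega>) (X 0 \<omega>)) \<partial>M)"
    by (intro nn_integral_cong) (auto simp: S last_path_prefix hd_path_prefix indicator_def)
  finally have le: "(\<integral>\<^sup>+\<omega>. ennreal (indicator B \<omega> * hit_prob P (X (Suc n) \<omega>) (X 0 \<omega>)) \<partial>M)
      \<le> (\<integral>\<^sup>+\<omega>. ennreal (indicator B \<omega> * hit_prob P (X n \<omega>) (X 0 \<omega>)) \<partial>M)" .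
  have int: "integrable M (\<lambda>\<omega>. indicator B \<omega> * hit_prob P (X n \<omega>) (X 0 \<omega>))" for n
    using abs_hit_prob_le_1 by (intro integrable_bounded[of _ 1]) (auto simp: indicator_def)
  have "ennreal (\<integral>\<omega>. indicator B \<omega> * hit_prob P (X n \<omega>) (X 0 \<omega>) \<partial>M) =
      (\<integral>\<^sup>+\<omega>. ennreal (indicator B \<omega> * hit_prob P (X n \<omega>) (X 0 \<omega>)) \<partial>M)" for n
    by (intro nn_integral_eq_integral[symmetric] int AE_I2 mult_nonneg_nonneg hit_prob_nonneg) simp
  then have "ennreal (\<integral>\<omega>. indicator B \<omega> * hit_prob P (X (Suc n) \<omega>) (X 0 \<omega>) \<partial>M)
      \<le> ennreal (\<integral>\<omega>. indicator B \<omega> * hit_prob P (X n \<omega>) (X 0 \<omega>) \<partial>M)"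
    using le by simp
  moreover have "0 \<le> (\<integral>\<omega>. indicator B \<omega> * hit_prob P (X n \<omega>) (X 0 \<omega>) \<partial>M)"
    by (intro integral_nonneg_AE AE_I2 mult_nonneg_nonneg hit_prob_nonneg) simp
  ultimately show ?thesis by (simp only: ennreal_le_iff)
qed

lemma hit_prob_unit_supermartingale:
  "unit_supermartingale M path_algebra (\<lambda>n \<omega>. hit_prob P (X n \<omega>) (X 0 \<omega>))"
proof
  fix n
  show "subalgebra M (path_algebra n)"
    using measurable_sets[OF path_prefix_measurable[of n]]
    by (auto simp: subalgebra_def sets_path_algebra space_path_algebra)
  show "sets (path_algebra n) \<subseteq> sets (path_algebra (Suc n))"
  proof
    fix B assume "B \<in> sets (path_algebra n)"
    then obtain S where "B = path_prefix X n -` S \<inter> space M" by (auto simp: sets_path_algebra)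
    then have "B = path_prefix X (Suc n) -` (butlast -` S) \<inter> space M" by (auto simp: path_prefix_Suc)
    then show "B \<in> sets (path_algebra (Suc n))" by (auto simp: sets_path_algebra)
  qed
  have "path_prefix X n \<in> measurable (path_algebra n) (count_space UNIV)"
    unfolding path_algebra_def by (rule measurable_vimage_algebra1) simp
  then have "(\<lambda>\<omega>. hit_prob P (last (path_prefix X n \<omega>)) (hd (path_prefix X n \<omega>))) \<in> borel_measurable (path_algebra n)"
    by measurable
  then show "(\<lambda>\<omega>. hit_prob P (X n \<omega>) (X 0 \<omega>)) \<in> borel_measurable (path_algebra n)"
    by (simp add: last_path_prefix hd_path_prefix)
qed (rule hit_prob_nonneg hit_prob_le_1 hit_prob_supermartingale; assumption?)+

end

section \<open>From escapes to cut times\<close>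

text \<open>A state visited both up to time \<open>n\<close> and later would have a single value of
  \<open>y\<close>, at least the running minimum and yet below it.\<close>

lemma cut_time_if_below_running_min:
  assumes y: "\<And>i j. x i = x j \<Longrightarrow> y i = y j" and below: "\<And>s. n < s \<Longrightarrow> y s < running_min y n"
  shows "cut_time x n"
  unfolding cut_time_def
proof (rule equals0I, elim IntE CollectE exE conjE)
  fix a i j assume "a = x i" "i \<le> n" "a = x j" "n < j"
  then have "y i = y j" by (intro y) simp
  moreover have "running_min y n \<le> y i" using \<open>i \<le> n\<close> by (rule running_min_le)
  ultimately show False using below[OF \<open>n < j\<close>] by simp
qed

text \<open>The finitely many early terms are absorbed by a maximum, since the path argument needs
  one constant for all times.\<close>

lemma bounded_if_limsup_finite:
  fixes f :: "nat \<Rightarrow> real"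
  assumes "limsup (\<lambda>n. ereal (f n)) < \<infinity>"
  shows "\<exists>C. \<forall>n. f n \<le> C"
proof -
  obtain c :: real where c: "limsup (\<lambda>n. ereal (f n)) < ereal c"
    using less_PInf_Ex_of_nat[THEN iffD1, OF less_imp_neq[OF assms]] by auto
  then have "eventually (\<lambda>n. ereal (f n) < ereal c) sequentially"
    by (rule Limsup_lessD)
  then obtain N where N: "\<And>n. N \<le> n \<Longrightarrow> f n < c" by (auto simp: eventually_sequentially)
  have "f n \<le> max c (Max (f ` {..N}))" for n
  proof (cases "N \<le> n")
    case True
    then show ?thesis using N[of n] by simp
  next
    case False
    then have "f n \<le> Max (f ` {..N})" by (intro Max_ge) auto
    then show ?thesis by simp
  qed
  then show ?thesis by blast
qed

theorem theorem2p1: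
  fixes M :: "'w measure" and P :: "'a::countable \<Rightarrow> 'a pmf" and dag :: 'a
    and X :: "nat \<Rightarrow> 'w \<Rightarrow> 'a" and \<phi> :: "real \<Rightarrow> real"
  assumes kill: "killing_chain P dag"
    and lf: "locally_finite P"
    and irr: "irreducible_chain P dag"
    and traj: "trajectory M P X"
    and trans: "transient_traj M X dag"
    and noloop: "\<forall>x. x \<noteq> dag \<longrightarrow> pmf (P x) x = 0"
    and phi_mono: "strict_mono_on {0..} \<phi>"
    and phi_bij: "bij_betw \<phi> {0..} {0..}"
    and phi_div: "\<not> summable (\<lambda>n. 1 / max 1 (ln (inv_into {0..} \<phi> (real (Suc n)))))"
    and G_pos: "measure M {\<omega> \<in> space M.
        limsup (\<lambda>n. ereal (exp (\<phi> (real n)) * hit_prob P (X n \<omega>) (X 0 \<omega>))) < \<infinity>} > 0"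
  shows "AE \<omega> in M.
           limsup (\<lambda>n. ereal (exp (\<phi> (real n)) * hit_prob P (X n \<omega>) (X 0 \<omega>))) < \<infinity>
           \<longrightarrow> ((\<exists>n. X n \<omega> = dag) \<or> infinite {n. cut_time (\<lambda>i. X i \<omega>) n})"
proof -
  let ?Y = "\<lambda>n \<omega>. hit_prob P (X n \<omega>) (X 0 \<omega>)"
  interpret unit_supermartingale M "path_algebra M X" ?Y
    by (rule hit_prob_unit_supermartingale[OF traj])
  show ?thesis
    using escape_infinitely_often
  proof eventually_elim
    fix \<omega>
    let ?y = "\<lambda>n. ?Y n \<omega>"
    assume esc: "(\<forall>K::nat. \<exists>N. real K \<le> (\<Sum>t<N. weighted_drop t \<omega>)) \<longrightarrow> (\<forall>m. \<exists>t\<ge>m. \<omega> \<in> escape t)"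
    show "limsup (\<lambda>n. ereal (exp (\<phi> (real n)) * ?Y n \<omega>)) < \<infinity>
      \<longrightarrow> ((\<exists>n. X n \<omega> = dag) \<or> infinite {n. cut_time (\<lambda>i. X i \<omega>) n})"
    proof
      assume fin: "limsup (\<lambda>n. ereal (exp (\<phi> (real n)) * ?Y n \<omega>)) < \<infinity>"
      show "(\<exists>n. X n \<omega> = dag) \<or> infinite {n. cut_time (\<lambda>i. X i \<omega>) n}"
      proof (cases "\<exists>n. X n \<omega> = dag")
        case False
        then have pos: "0 < ?Y n \<omega>" for n by (intro hit_prob_pos[OF irr]) auto
        obtain C where "\<forall>n. exp (\<phi> (real n)) * ?Y n \<omega> \<le> C"
          using bounded_if_limsup_finite[OF fin] ..
        then have C: "?Y n \<omega> * exp (\<phi> (real n)) \<le> C" for n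
          unfolding mult.commute[of "?Y n \<omega>"] by (rule spec)
        \<comment> \<open>On a path that is never killed the hitting probabilities are positive, and
          the finite limsup provides \<open>C\<close>, so the deterministic divergence result
          applies to this path.\<close>
        have "\<not> summable (\<lambda>n. weighted_drop n \<omega>)"
          unfolding weighted_drop_def drop_at_def
          by (rule not_summable_weighted_drops[OF pos C phi_mono phi_bij phi_div])
        moreover have "summable (\<lambda>n. weighted_drop n \<omega>)"
          if "\<And>N. \<not> real K \<le> (\<Sum>t<N. weighted_drop t \<omega>)" for K :: nat
          using that by (intro summableI_nonneg_bounded[of _ "real K"] weighted_drop_nonneg) (simp add: less_imp_le not_le)
        ultimately have "\<exists>N. real K \<le> (\<Sum>t<N. weighted_drop t \<omega>)" for K :: nat by blast
        then have inf: "\<forall>m. \<exists>t\<ge>m. \<omega> \<in> escape t" by (intro esc[rule_format] allI)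
        have cut: "cut_time (\<lambda>i. X i \<omega>) t" if t: "\<omega> \<in> escape t" for t
        proof (rule cut_time_if_below_running_min[where y = ?y])
          show "?y s < running_min ?y t" if "t < s" for s
            using t that unfolding escape_def low_def by blast
        qed (simp only:)
        have "\<exists>t\<ge>m. t \<in> {n. cut_time (\<lambda>i. X i \<omega>) n}" for m
          using inf[rule_format, of m] cut by (elim exE conjE) (intro exI conjI CollectI)
        then show ?thesis unfolding infinite_nat_iff_unbounded_le by (intro disjI2 allI)
      qed simp
    qed
  qed
qed

end
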